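(* Let $\gamma:[0,T]\to \mathrm{Gr}(r,m)$ be a $C^2$ curve. Let $t_i=ih$, $\mathcal{Y}_i=\gamma(t_i)$, and define, for $t=t_i+\tau h$ with $0\le\tau\le 1$, $$\widehat\gamma_h(t)=\mathrm{GLERP}(\mathcal{Y}_i,\mathcal{Y}_{i+1};\tau).$$ Assume that $h$ is sufficiently small so that $\gamma([t_i,t_{i+1}])$, $\mathcal{Y}_i$, and $\mathcal{Y}_{i+1}$ lie in a common normal coordinate neighborhood. Then there exists a constant $C$, independent of $h$ and $\tau$, such that $$d_{\mathrm{Gr}}\bigl(\gamma(t_i+\tau h),\widehat\gamma_h(t_i+\tau h)\bigr)\le C h^2,\qquad 0\le\tau\le 1.$$
   Context: $\mathrm{Gr}(r,m)$ is the Grassmann manifold of $r$-dimensional linear subspaces of $\mathbb{R}^m$. A point $\mathcal{Y}$ is represented by $Y\in\mathbb{R}^{m\times r}$ with $Y^TY=I_r$ and $\mathcal{Y}=\mathrm{span}(Y)$ (column span); $Y$ and $YR$, $R\in O(r)$, represent the same point. The tangent space at $\mathcal{Y}$ is identified with $\{\Delta\in\mathbb{R}^{m\times r}:Y^T\Delta=0\}$, with the canonical metric $\langle\Delta_1,\Delta_2\rangle=\mathrm{tr}(\Delta_1^T\Delta_2)$. The principal angles $\theta_1,\ldots,\theta_r\in[0,\pi/2]$ between $\mathrm{span}(Y_0)$ and $\mathrm{span}(Y_1)$ are those for which $\cos\theta_j$ are the singular values of $Y_0^TY_1$, and the geodesic distance is $d_{\mathrm{Gr}}=(\sum_{j=1}^r\theta_j^2)^{1/2}$.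 Exponential map: if $\Delta=U\Theta V^T$ is a compact singular value decomposition of a tangent vector at $\mathcal{Y}=\mathrm{span}(Y)$, then $\mathrm{Exp}_{\mathcal{Y}}(\Delta)=\mathrm{span}(YV\cos\Theta+U\sin\Theta)$. Logarithm map: for $\mathcal{Y}_0=\mathrm{span}(Y_0)$ and $\mathcal{Y}_1=\mathrm{span}(Y_1)$ sufficiently close so that $Y_0^TY_1$ is invertible, $\mathrm{Log}_{\mathcal{Y}_0}(\mathcal{Y}_1)=U\arctan(\Sigma)V^T$, where $Y_1(Y_0^TY_1)^{-1}-Y_0=U\Sigma V^T$ is a compact singular value decomposition. Grassmann linear interpolation: for $\mathcal{Y}_1$ in the injectivity neighborhood of $\mathcal{Y}_0$ (a sufficient condition is that all principal angles between them are strictly smaller than $\pi/2$), $\mathrm{GLERP}(\mathcal{Y}_0,\mathcal{Y}_1;\tau)=\mathrm{Exp}_{\mathcal{Y}_0}\bigl(\tau\,\mathrm{Log}_{\mathcal{Y}_0}(\mathcal{Y}_1)\bigr)$, $0\le\tau\le1$. A normal coordinate neighborhood is a neighborhood on which normal coordinates (given by the inverse of the exponential map at a point) are defined, so that the logarithm map is single-valued there. The index $i$ refers to an interpolation interval $[t_i,t_{i+1}]\subset[0,T]$. *)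

theory Defs
  imports "HOL-Analysis.Analysis"
begin

text \<open>The dimensions are \<open>m = CARD('m)\<close> and \<open>r = CARD('r)\<close>. An \<open>m \<times> r\<close> matrix has type
  \<open>real^'r^'m\<close>; a point of the Grassmannian is the subspace itself, of type \<open>(real^'m) set\<close>.
  As \<open>r\<close> is not visible in that type, some constants take a \<open>'r itself\<close> argument.\<close>

definition grassmannian :: "nat \<Rightarrow> (real^'m::finite) set set" where
  "grassmannian r = {S. subspace S \<and> dim S = r}"

definition stiefel :: "(real^'r::finite^'m::finite) set" where
  "stiefel = {Y. transpose Y ** Y = mat 1}"

definition col_span :: "real^'r::finite^'m::finite \<Rightarrow> (real^'m) set" where
  "col_span Y = span (columns Y)"

text \<open>An arbitrary orthonormal representative. All notions below that use it are invariant under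
  \<open>Y \<mapsto> Y R\<close> with \<open>R\<close> orthogonal.\<close>

definition gr_rep :: "(real^'m::finite) set \<Rightarrow> real^'r::finite^'m" where
  "gr_rep S = (SOME Y. Y \<in> stiefel \<and> col_span Y = S)"

definition horizontal_space :: "real^'r::finite^'m::finite \<Rightarrow> (real^'r^'m) set" where
  "horizontal_space Y = {\<Delta>. transpose Y ** \<Delta> = 0}"

definition diag_mat :: "real^'r::finite \<Rightarrow> real^'r^'r" where
  "diag_mat d = (\<chi> i j. if i = j then d $ i else 0)"

text \<open>Compact SVD \<open>A = U diag(\<sigma>) V\<^sup>T\<close> with \<open>U\<close> of the shape of \<open>A\<close>; singular values may vanish,
  and no ordering of them is imposed.\<close>

definition is_compact_svd ::
    "real^'r::finite^'m::finite \<Rightarrow> real^'r^'m \<Rightarrow> real^'r \<Rightarrow> real^'r^'r \<Rightarrow> bool" where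
  "is_compact_svd A U \<sigma> V \<longleftrightarrow>
     transpose U ** U = mat 1 \<and> orthogonal_matrix V \<and> (\<forall>j. 0 \<le> \<sigma> $ j) \<and>
     A = U ** diag_mat \<sigma> ** transpose V"

definition gr_exp :: "real^'r::finite^'m::finite \<Rightarrow> real^'r^'m \<Rightarrow> (real^'m) set" where
  "gr_exp Y \<Delta> =
     (case (SOME (U, \<theta>, V). is_compact_svd \<Delta> U \<theta> V) of (U, \<theta>, V) \<Rightarrow>
        col_span (Y ** V ** diag_mat (\<chi> j. cos (\<theta> $ j)) + U ** diag_mat (\<chi> j. sin (\<theta> $ j))))"

text \<open>Domain and value of the standard affine (graph) chart centred at \<open>col_span Y\<^sub>0\<close>, with values in
  \<open>horizontal_space Y\<^sub>0\<close>. The domain is also the set on which the logarithm at \<open>col_span Y\<^sub>0\<close> is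
  defined (all principal angles strictly below \<open>\<pi>/2\<close>), i.e. the injectivity neighbourhood.\<close>

definition gr_chart_domain :: "real^'r::finite^'m::finite \<Rightarrow> (real^'m) set set" where
  "gr_chart_domain Y\<^sub>0 = {col_span Y | Y :: real^'r^'m. Y \<in> stiefel \<and> invertible (transpose Y\<^sub>0 ** Y)}"

definition gr_chart :: "real^'r::finite^'m::finite \<Rightarrow> (real^'m) set \<Rightarrow> real^'r^'m" where
  "gr_chart Y\<^sub>0 S = (let Y = (gr_rep S :: real^'r^'m) in Y ** matrix_inv (transpose Y\<^sub>0 ** Y) - Y\<^sub>0)"

definition gr_log :: "real^'r::finite^'m::finite \<Rightarrow> (real^'m) set \<Rightarrow> real^'r^'m" where
  "gr_log Y\<^sub>0 S =
     (case (SOME (U, \<sigma>, V). is_compact_svd (gr_chart Y\<^sub>0 S) U \<sigma> V) of (U, \<sigma>, V) \<Rightarrow>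
        U ** diag_mat (\<chi> j. arctan (\<sigma> $ j)) ** transpose V)"

definition glerp ::
    "'r::finite itself \<Rightarrow> (real^'m::finite) set \<Rightarrow> (real^'m) set \<Rightarrow> real \<Rightarrow> (real^'m) set" where
  "glerp _ S\<^sub>0 S\<^sub>1 \<tau> =
     (let Y\<^sub>0 = (gr_rep S\<^sub>0 :: real^'r^'m) in gr_exp Y\<^sub>0 (\<tau> *\<^sub>R gr_log Y\<^sub>0 S\<^sub>1))"

text \<open>Principal angles are determined only up to order.\<close>

definition principal_angles ::
    "(real^'m::finite) set \<Rightarrow> (real^'m) set \<Rightarrow> real^'r::finite \<Rightarrow> bool" where
  "principal_angles S\<^sub>0 S\<^sub>1 \<theta> \<longleftrightarrow>
     (\<forall>j. 0 \<le> \<theta> $ j \<and> \<theta> $ j \<le> pi / 2) \<and>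
     (\<exists>(Y\<^sub>0 :: real^'r^'m) Y\<^sub>1 U V. Y\<^sub>0 \<in> stiefel \<and> Y\<^sub>1 \<in> stiefel \<and>
        col_span Y\<^sub>0 = S\<^sub>0 \<and> col_span Y\<^sub>1 = S\<^sub>1 \<and>
        is_compact_svd (transpose Y\<^sub>0 ** Y\<^sub>1) U (\<chi> j. cos (\<theta> $ j)) V)"

definition gr_dist ::
    "'r::finite itself \<Rightarrow> (real^'m::finite) set \<Rightarrow> (real^'m) set \<Rightarrow> real" where
  "gr_dist _ S\<^sub>0 S\<^sub>1 =
     (let \<theta> = (SOME \<theta> :: real^'r. principal_angles S\<^sub>0 S\<^sub>1 \<theta>) in sqrt (\<Sum>j\<in>UNIV. (\<theta> $ j)\<^sup>2))"

text \<open>Normal coordinates on \<open>N\<close> are the inverse of the exponential map at \<open>col_span Y\<close>, restricted to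
  an open neighbourhood of 0 in the tangent space on which it is injective. Neither star-shapedness
  nor smoothness of the inverse is demanded, which makes this weaker than the usual notion.\<close>

definition normal_coordinate_nbhd :: "'r::finite itself \<Rightarrow> (real^'m::finite) set set \<Rightarrow> bool" where
  "normal_coordinate_nbhd _ N \<longleftrightarrow>
     (\<exists>(Y :: real^'r^'m) D. Y \<in> stiefel \<and>
        openin (top_of_set (horizontal_space Y)) D \<and> 0 \<in> D \<and>
        inj_on (gr_exp Y) D \<and> N = gr_exp Y ` D)"

definition C2_on :: "real set \<Rightarrow> (real \<Rightarrow> 'a::real_normed_vector) \<Rightarrow> bool" where
  "C2_on J f \<longleftrightarrow>
     (\<exists>f' f''. (\<forall>t\<in>J. (f has_vector_derivative f' t) (at t within J) \<and>
                     (f' has_vector_derivative f'' t) (at t within J)) \<and>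
               continuous_on J f'')"

text \<open>\<open>C\<^sup>2\<close> as a map into the manifold: near each parameter, \<open>\<gamma>\<close> stays in the domain of one of the
  affine charts, and its coordinate expression is \<open>C\<^sup>2\<close> (one-sided at end points of \<open>I\<close>).\<close>

definition gr_C2_curve_on ::
    "'r::finite itself \<Rightarrow> real set \<Rightarrow> (real \<Rightarrow> (real^'m::finite) set) \<Rightarrow> bool" where
  "gr_C2_curve_on _ I \<gamma> \<longleftrightarrow>
     (\<forall>t\<in>I. \<exists>(Y\<^sub>0 :: real^'r^'m) W. Y\<^sub>0 \<in> stiefel \<and> open W \<and> t \<in> W \<and>
        \<gamma> ` (W \<inter> I) \<subseteq> gr_chart_domain Y\<^sub>0 \<and> C2_on (W \<inter> I) (\<lambda>s. gr_chart Y\<^sub>0 (\<gamma> s)))"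

end

theory Submission
  imports Defs
begin

text \<open>Near each parameter the curve has a \<open>C\<^sup>2\<close> frame \<open>Z\<close>, the graph frame of an affine chart, which
  deviates from its chord over \<open>[t\<^sub>i, t\<^sub>i\<^sub>+\<^sub>1]\<close> by \<open>O(h\<^sup>2)\<close>. The geodesic has the orthonormal frame
  \<open>W\<^sub>\<tau> = Y V cos(\<tau>\<Theta>) + U sin(\<tau>\<Theta>)\<close>, which deviates from its chord by \<open>O(|\<Theta>|\<^sup>2) = O(h\<^sup>2)\<close>. At both end
  points the frames span the same subspace, \<open>Z\<^sub>i = W\<^sub>i M\<^sub>i\<close>, and so \<open>Z\<^sub>\<tau> - W\<^sub>\<tau> M\<^sub>\<tau> = O(h\<^sup>2)\<close> for the chord
  \<open>M\<^sub>\<tau>\<close> of \<open>M\<close>. Such a residual bounds the distance, as the squared sines of the principal angles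
  between \<open>span(Y)\<close> and \<open>span(W)\<close> add up to the minimum of \<open>|Y - W M|\<^sup>2\<close> over all \<open>M\<close>. The local
  constants are made uniform by compactness of \<open>[0, T]\<close>; for \<open>h\<close> bounded away from \<open>0\<close> boundedness of
  the distance suffices.\<close>

subsection \<open>Frobenius norm\<close>

lemma matrix_mult_component: "(A ** B) $ i $ j = A $ i \<bullet> column j B" for A :: "real^'n^'m"
  by (simp add: matrix_matrix_mult_def column_def inner_vec_def)

lemma norm_vec_power2: "(norm x)\<^sup>2 = (\<Sum>i\<in>UNIV. (norm (x $ i))\<^sup>2)" for x :: "'a::real_normed_vector^'n"
  by (simp add: norm_vec_def L2_set_def sum_nonneg)

lemma norm_matrix_power2: "(norm A)\<^sup>2 = (\<Sum>i\<in>UNIV. \<Sum>j\<in>UNIV. (A $ i $ j)\<^sup>2)" for A :: "real^'n^'m"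
  by (simp add: norm_vec_power2)

lemma norm_matrix_power2_columns: "(norm A)\<^sup>2 = (\<Sum>j\<in>UNIV. (norm (column j A))\<^sup>2)" for A :: "real^'n^'m"
  unfolding norm_matrix_power2 by (subst sum.swap) (simp add: norm_vec_power2 column_def)

text \<open>Cauchy-Schwarz for each entry, which is the inner product of a row of \<open>A\<close>
  and a column of \<open>B\<close>; the double sum of the bounds then factors.\<close>

lemma norm_matrix_mult_le: "norm (A ** B) \<le> norm A * norm B" for A :: "real^'n^'m" and B :: "real^'p^'n"
proof (rule power2_le_imp_le)
  have "(norm (A ** B))\<^sup>2 \<le> (\<Sum>i\<in>UNIV. \<Sum>j\<in>UNIV. (norm (A $ i))\<^sup>2 * (norm (column j B))\<^sup>2)"
    unfolding norm_matrix_power2 matrix_mult_component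
    by (intro sum_mono) (metis Cauchy_Schwarz_ineq power2_norm_eq_inner)
  also have "\<dots> = (norm A)\<^sup>2 * (norm B)\<^sup>2"
    by (simp add: norm_matrix_power2_columns[of B] norm_vec_power2[of A] sum_product)
  finally show "(norm (A ** B))\<^sup>2 \<le> (norm A * norm B)\<^sup>2"
    by (simp add: power_mult_distrib)
qed simp

lemma bounded_bilinear_matrix_mult: "bounded_bilinear ((**) :: real^'n^'m \<Rightarrow> real^'p^'n \<Rightarrow> real^'p^'m)"
proof
  show "\<exists>K. \<forall>(A :: real^'n^'m) (B :: real^'p^'n). norm (A ** B) \<le> norm A * norm B * K"
    by (rule exI[of _ 1]) (simp add: norm_matrix_mult_le)
qed (auto simp: matrix_matrix_mult_def vec_eq_iff sum_distrib_left algebra_simps sum.distrib)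

lemmas matrix_diff_left = bounded_bilinear.diff_left[OF bounded_bilinear_matrix_mult]
lemmas matrix_diff_right = bounded_bilinear.diff_right[OF bounded_bilinear_matrix_mult]
lemmas matrix_add_left = bounded_bilinear.add_left[OF bounded_bilinear_matrix_mult]
lemmas matrix_add_right = bounded_bilinear.add_right[OF bounded_bilinear_matrix_mult]
lemmas matrix_scaleR_left = bounded_bilinear.scaleR_left[OF bounded_bilinear_matrix_mult]
lemmas matrix_scaleR_right = bounded_bilinear.scaleR_right[OF bounded_bilinear_matrix_mult]
lemmas matrix_bilinear = matrix_diff_left matrix_diff_right matrix_add_left matrix_add_right
  matrix_scaleR_left matrix_scaleR_right

text \<open>The inner product of matrices is the trace form, so multiplication by
  \<open>transpose A\<close> is adjoint to multiplication by \<open>A\<close>. Orthogonality and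
  isometry thereby reduce to Gram matrices.\<close>

lemma inner_matrix_mult_left: "(A ** B) \<bullet> C = B \<bullet> (transpose A ** C)"
  for A :: "real^'n^'m" and B :: "real^'p^'n" and C :: "real^'p^'m"
proof -
  have "(A ** B) \<bullet> C = (\<Sum>i\<in>UNIV. \<Sum>j\<in>UNIV. \<Sum>k\<in>UNIV. A$i$k * B$k$j * C$i$j)"
    by (simp add: inner_vec_def matrix_matrix_mult_def sum_distrib_right)
  also have "\<dots> = (\<Sum>i\<in>UNIV. \<Sum>k\<in>UNIV. \<Sum>j\<in>UNIV. A$i$k * B$k$j * C$i$j)"
    by (intro sum.cong refl) (rule sum.swap)
  also have "\<dots> = (\<Sum>k\<in>UNIV. \<Sum>i\<in>UNIV. \<Sum>j\<in>UNIV. A$i$k * B$k$j * C$i$j)"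
    by (rule sum.swap)
  also have "\<dots> = (\<Sum>k\<in>UNIV. \<Sum>j\<in>UNIV. \<Sum>i\<in>UNIV. A$i$k * B$k$j * C$i$j)"
    by (intro sum.cong refl) (rule sum.swap)
  also have "\<dots> = B \<bullet> (transpose A ** C)"
    by (simp add: inner_vec_def matrix_matrix_mult_def transpose_def sum_distrib_left mult_ac)
  finally show ?thesis .
qed

lemma norm_transpose: "norm (transpose A) = norm A" for A :: "real^'n^'m"
proof -
  have "(norm (transpose A))\<^sup>2 = (norm A)\<^sup>2"
    unfolding norm_matrix_power2 by (subst sum.swap) (simp add: transpose_def)
  then show ?thesis by (simp add: power2_eq_iff_nonneg)
qed

lemma norm_isometry_mult:
  fixes U :: "real^'n^'m" and A :: "real^'p^'n"
  assumes "transpose U ** U = mat 1"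
  shows "norm (U ** A) = norm A"
  by (simp add: norm_eq_sqrt_inner inner_matrix_mult_left matrix_mul_assoc assms)

lemma norm_mult_isometry_transpose:
  fixes V :: "real^'n^'p" and A :: "real^'n^'m"
  assumes "transpose V ** V = mat 1"
  shows "norm (A ** transpose V) = norm A"
  by (metis assms matrix_transpose_mul norm_isometry_mult norm_transpose transpose_transpose)

lemma norm_mat_1_power2: "(norm (mat 1 :: real^'n^'n))\<^sup>2 = CARD('n)"
  unfolding norm_matrix_power2 by (simp add: mat_def if_distrib[of "\<lambda>x. x^2"] cong: if_cong)

lemma norm_stiefel:
  fixes Y :: "real^'r^'m"
  assumes "Y \<in> stiefel"
  shows "norm Y = sqrt CARD('r)"
proof -
  have "norm (Y ** (mat 1 :: real^'r^'r)) = norm (mat 1 :: real^'r^'r)"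
    using assms by (intro norm_isometry_mult) (simp add: stiefel_def)
  then show ?thesis
    by (metis matrix_mul_rid norm_ge_zero norm_mat_1_power2 real_sqrt_unique)
qed

section \<open>Diagonal matrices and column spans\<close>

lemma diag_mat_mult_right: "(A ** diag_mat d) $ i $ j = A $ i $ j * d $ j" for A :: "real^'n^'m"
  by (simp add: matrix_matrix_mult_def diag_mat_def if_distrib[of "\<lambda>x. _ * x"] cong: if_cong)

lemma diag_mat_mult_left: "(diag_mat d ** A) $ i $ j = d $ i * A $ i $ j" for A :: "real^'n^'m"
  by (simp add: matrix_matrix_mult_def diag_mat_def if_distrib[of "\<lambda>x. x * _"] cong: if_cong)

lemma transpose_diag_mat: "transpose (diag_mat d) = diag_mat d"
  by (auto simp: transpose_def diag_mat_def vec_eq_iff)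

lemma diag_mat_mult: "diag_mat c ** diag_mat d = diag_mat (\<chi> j. c $ j * d $ j)"
  by (simp add: vec_eq_iff diag_mat_mult_right) (simp add: diag_mat_def)

lemma norm_diag_mat: "norm (diag_mat d) = norm d"
proof -
  have "(norm (diag_mat d))\<^sup>2 = (norm d)\<^sup>2"
    unfolding norm_matrix_power2
    by (simp add: norm_vec_power2 diag_mat_def if_distrib[of "\<lambda>x. x^2"] cong: if_cong)
  then show ?thesis by (simp add: power2_eq_iff_nonneg)
qed

text \<open>The columns are the images of the standard basis. Seen as ranges, column spans can be
  compared through right factors of the matrices.\<close>

lemma col_span_eq_range: "col_span Y = range ((*v) Y)" for Y :: "real^'n^'m"
proof -
  have "range (\<lambda>i. axis i 1 :: real^'n) = Basis"
    by (auto simp: Basis_vec_def)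
  then show ?thesis
    unfolding col_span_def columns_image_basis
    by (simp add: linear_span_image matrix_vector_mul_linear)
qed

subsection \<open>Singular value decomposition\<close>

text \<open>A zero of a nonnegative quadratic form is a minimum, so the first variation vanishes
  there. Moving from \<open>v\<close> by a small step along \<open>- f v\<close> would otherwise
  make the form negative.\<close>

lemma psd_form_kernel:
  fixes f :: "'a::real_inner \<Rightarrow> 'a"
  assumes f: "linear f" and sym: "\<And>x y. f x \<bullet> y = x \<bullet> f y"
    and S: "subspace S" "f ` S \<subseteq> S"
    and psd: "\<And>x. x \<in> S \<Longrightarrow> 0 \<le> x \<bullet> f x"
    and v: "v \<in> S" "v \<bullet> f v = 0"
  shows "f v = 0"
proof (rule ccontr)
  assume "f v \<noteq> 0"
  define u where "u = f v"
  have u: "u \<in> S" "u \<noteq> 0"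
    using S v \<open>f v \<noteq> 0\<close> by (auto simp: u_def)
  define a where "a = u \<bullet> u"
  define b where "b = u \<bullet> f u"
  have a: "0 < a" using u by (simp add: a_def)
  have b: "0 \<le> b" using psd u by (simp add: b_def)
  \<comment> \<open>The form at \<open>v - t *\<^sub>R u\<close> equals
    \<open>t * (t * b - 2 * a)\<close>, negative for this \<open>t\<close>; the summand 1 covers the
    case \<open>b = 0\<close>.\<close>
  define t where "t = a / (b + 1)"
  have t: "0 < t" "t * b < 2 * a"
    using a b by (auto simp: t_def field_simps add_strict_increasing2)
  have "v - t *\<^sub>R u \<in> S"
    using S u v by (simp add: subspace_diff subspace_scale)
  then have "0 \<le> (v - t *\<^sub>R u) \<bullet> f (v - t *\<^sub>R u)"
    by (rule psd)
  also have "\<dots> = t * (t * b - 2 * a)"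
    using v sym[of v u]
    by (simp add: linear_diff[OF f] linear_scale[OF f] inner_diff a_def b_def u_def
        inner_commute algebra_simps)
  finally show False
    using t by (simp add: zero_le_mult_iff)
qed

text \<open>The Rayleigh quotient attains its maximum \<open>c\<close> on the compact unit sphere of
  \<open>S\<close>, at \<open>v\<close> say. Then \<open>c\<close> times the identity minus
  \<open>f\<close> is nonnegative on \<open>S\<close> with form zero at \<open>v\<close>, and
  \<open>psd_form_kernel\<close> applies.\<close>

lemma symmetric_eigenvector_exists:
  fixes f :: "'a::euclidean_space \<Rightarrow> 'a"
  assumes f: "linear f" and sym: "\<And>x y. f x \<bullet> y = x \<bullet> f y"
    and S: "subspace S" "f ` S \<subseteq> S" "dim S > 0"
  shows "\<exists>v\<in>S. norm v = 1 \<and> (\<exists>c. f v = c *\<^sub>R v)"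
proof -
  obtain x where x: "x \<in> S" "x \<noteq> 0"
    using S by (metis dim_eq_0 less_irrefl subsetI singleton_iff)
  have "compact (S \<inter> sphere 0 1)"
    using S by (simp add: closed_Int_compact closed_subspace)
  moreover have "(1 / norm x) *\<^sub>R x \<in> S \<inter> sphere 0 1"
    using x S by (simp add: subspace_scale)
  then have "S \<inter> sphere 0 1 \<noteq> {}" by blast
  moreover have "continuous_on (S \<inter> sphere 0 1) (\<lambda>x. x \<bullet> f x)"
    using f by (intro continuous_intros linear_continuous_on) (simp add: linear_conv_bounded_linear)
  ultimately obtain v where v: "v \<in> S \<inter> sphere 0 1"
    and max: "\<And>y. y \<in> S \<inter> sphere 0 1 \<Longrightarrow> y \<bullet> f y \<le> v \<bullet> f v"
    using continuous_attains_sup by metis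
  define c where "c = v \<bullet> f v"
  define g where "g x = c *\<^sub>R x - f x" for x
  have "g v = 0"
  proof (rule psd_form_kernel[where S = S and f = g])
    show "linear g"
      unfolding g_def by (intro linear_compose_sub linear_compose_scale_right f linear_id[unfolded id_def])
    show "g x \<bullet> y = x \<bullet> g y" for x y
      by (simp add: g_def inner_diff sym)
    show "g ` S \<subseteq> S"
      using S by (auto simp: g_def intro!: subspace_diff subspace_scale)
    show "0 \<le> x \<bullet> g x" if "x \<in> S" for x
    proof (cases "x = 0")
      case False
      let ?y = "(1 / norm x) *\<^sub>R x"
      have "?y \<in> S \<inter> sphere 0 1"
        using False that S by (simp add: subspace_scale)
      from max[OF this] have "(x \<bullet> f x) / (norm x)\<^sup>2 \<le> c"
        by (simp add: linear_scale[OF f] c_def power2_eq_square)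
      then show ?thesis
        using False by (simp add: g_def inner_diff field_simps dot_square_norm)
    qed (simp add: g_def linear_0[OF f])
    show "v \<in> S" "v \<bullet> g v = 0"
      using v by (auto simp: g_def inner_diff c_def dot_square_norm)
  qed (use S in simp)
  then show ?thesis
    using v by (auto simp: g_def intro!: bexI[of _ v] exI[of _ c])
qed

text \<open>Induction on the dimension: by symmetry, the orthogonal complement in \<open>S\<close>
  of an eigenvector is again invariant.\<close>

lemma symmetric_orthonormal_eigenbasis:
  fixes f :: "'a::euclidean_space \<Rightarrow> 'a"
  assumes f: "linear f" and sym: "\<And>x y. f x \<bullet> y = x \<bullet> f y"
    and "subspace S" "f ` S \<subseteq> S"
  shows "\<exists>B\<subseteq>S. finite B \<and> card B = dim S \<and> pairwise orthogonal B \<and>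
           (\<forall>v\<in>B. norm v = 1 \<and> (\<exists>c. f v = c *\<^sub>R v))"
  using assms(3,4)
proof (induction "dim S" arbitrary: S)
  case 0
  then show ?case by (intro exI[of _ "{}"]) auto
next
  case (Suc n)
  then obtain v c where v: "v \<in> S" "norm v = 1" "f v = c *\<^sub>R v"
    using symmetric_eigenvector_exists[OF f sym, of S] by auto
  define S' where "S' = {y \<in> S. orthogonal v y}"
  have "S' = {y \<in> S. \<forall>x\<in>span {v}. orthogonal x y}"
    unfolding S'_def by (auto simp: span_singleton orthogonal_def)
  moreover have "span {v} \<subseteq> S"
    using v Suc.prems by (simp add: span_minimal)
  moreover have "dim (span {v}) = 1"
    using v by (auto simp: dim_singleton)
  ultimately have dimS': "n = dim S'"
    using dim_subspace_orthogonal_to_vectors[of "span {v}" S] Suc by simp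
  have "subspace S'"
    using Suc.prems by (auto simp: S'_def subspace_def orthogonal_def inner_add inner_scaleR)
  moreover have "f ` S' \<subseteq> S'"
    using Suc.prems by (auto simp: S'_def orthogonal_def sym[symmetric] v)
  ultimately obtain B where B: "B \<subseteq> S'" "finite B" "card B = n" "pairwise orthogonal B"
    "\<forall>v\<in>B. norm v = 1 \<and> (\<exists>c. f v = c *\<^sub>R v)"
    using Suc.hyps(1)[OF dimS'] dimS' by auto
  have "v \<notin> B"
    using v B(1) by (auto simp: S'_def orthogonal_def dot_square_norm)
  then show ?case
    using B v Suc.hyps(2)
    by (intro exI[of _ "insert v B"])
      (auto simp: S'_def pairwise_insert orthogonal_commute)
qed

text \<open>Indexed families rather than sets, because the vectors become columns of matrices and
  because a family given on some of the indices has to be extended to all of them.\<close>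

definition orthonormal_family :: "('i \<Rightarrow> 'a::real_inner) \<Rightarrow> 'i set \<Rightarrow> bool" where
  "orthonormal_family v J \<longleftrightarrow> (\<forall>i\<in>J. \<forall>j\<in>J. v i \<bullet> v j = (if i = j then 1 else 0))"

lemma orthonormal_familyI:
  fixes B :: "'a::real_inner set"
  assumes "pairwise orthogonal B" "\<forall>v\<in>B. norm v = 1" "inj_on v J" "v ` J \<subseteq> B"
  shows "orthonormal_family v J"
proof -
  have "v i \<bullet> v j = 0" if "i \<in> J" "j \<in> J" "i \<noteq> j" for i j
    using assms that by (metis image_subset_iff inj_on_eq_iff orthogonal_def pairwiseD)
  moreover have "v i \<bullet> v i = 1" if "i \<in> J" for i
    using assms that by (auto simp: dot_square_norm)
  ultimately show ?thesis
    by (auto simp: orthonormal_family_def)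
qed

text \<open>Supplies left singular vectors for vanishing singular values. The orthogonal complement
  of the given vectors has dimension at least the number of missing indices, so an orthonormal basis
  of it fills the gaps.\<close>

lemma orthonormal_family_extend:
  fixes v :: "'i::finite \<Rightarrow> 'a::euclidean_space"
  assumes v: "orthonormal_family v J" and card: "CARD('i) \<le> DIM('a)"
  shows "\<exists>w. orthonormal_family w UNIV \<and> (\<forall>j\<in>J. w j = v j)"
proof -
  define C where "C = {y. \<forall>x\<in>span (v ` J). orthogonal x y}"
  have "dim C + dim (span (v ` J)) = DIM('a)"
    using dim_subspace_orthogonal_to_vectors[of "span (v ` J)" UNIV] by (simp add: C_def)
  moreover have "dim (span (v ` J)) \<le> card J"
    by (metis card_image_le dim_le_card' dim_span finite finite_imageI le_trans)
  ultimately have "card (- J) \<le> dim C"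
    using card by (simp add: card_Diff_subset Compl_eq_Diff_UNIV)
  moreover have "subspace C"
    unfolding C_def subspace_def orthogonal_def by (simp add: inner_add)
  then obtain B where B: "B \<subseteq> C" "pairwise orthogonal B" "\<And>x. x \<in> B \<Longrightarrow> norm x = 1"
    "independent B" "card B = dim C"
    by (metis orthonormal_basis_subspace)
  ultimately obtain g where g: "g ` (- J) \<subseteq> B" "inj_on g (- J)"
    by (metis card_le_inj finite finiteI_independent)
  have og: "orthonormal_family g (- J)"
    using orthonormal_familyI B g by metis
  define w where "w j = (if j \<in> J then v j else g j)" for j
  have cross: "v i \<bullet> g j = 0" if "i \<in> J" "j \<notin> J" for i j
  proof -
    have "g j \<in> C" using g B that by auto
    then show ?thesis using that by (auto simp: C_def span_base orthogonal_def)
  qed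
  have "orthonormal_family w UNIV"
    using v og cross unfolding orthonormal_family_def w_def
    by (auto simp: inner_commute)
  then show ?thesis
    by (auto simp: w_def)
qed

lemma orthonormal_family_matrix:
  fixes v :: "'r::finite \<Rightarrow> real^'m"
  assumes "orthonormal_family v UNIV"
  shows "transpose (\<chi> i j. v j $ i) ** (\<chi> i j. v j $ i) = mat 1"
  using assms unfolding matrix_mult_transpose_dot_column orthonormal_family_def
  by (simp add: vec_eq_iff mat_def column_def)

text \<open>The right singular vectors form an orthonormal eigenbasis of
  \<open>transpose A ** A\<close>. Their images under \<open>A\<close> are orthogonal with norms
  \<sigma>; the nonzero ones are normalised, and the family is completed to orthonormal vectors, for
  which there is room by \<open>card\<close>.\<close>

lemma compact_svd_exists:
  fixes A :: "real^'r^'m"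
  assumes card: "CARD('r) \<le> CARD('m)"
  shows "\<exists>U \<sigma> V. is_compact_svd A U \<sigma> V"
proof -
  define f where "f x = transpose A *v (A *v x)" for x
  have "linear f"
    unfolding linear_iff
    by (simp add: f_def matrix_vector_right_distrib matrix_vector_mult_scaleR)
  have f: "x \<bullet> f y = (A *v x) \<bullet> (A *v y)" for x y
    by (metis f_def dot_lmul_matrix inner_commute transpose_matrix_vector)
  have sym: "f x \<bullet> y = x \<bullet> f y" for x y
    using f[of x y] f[of y x] by (simp add: inner_commute)
  obtain B where B: "finite B" "card B = CARD('r)" "pairwise orthogonal B"
    "\<And>v. v \<in> B \<Longrightarrow> norm v = 1 \<and> (\<exists>c. f v = c *\<^sub>R v)"
    using symmetric_orthonormal_eigenbasis[OF \<open>linear f\<close> sym, of UNIV] by auto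
  obtain v :: "'r \<Rightarrow> _" where v: "bij_betw v UNIV B"
    by (metis B(1,2) finite finite_same_card_bij)
  then have ov: "orthonormal_family v UNIV"
    using orthonormal_familyI[of B v UNIV] B by (auto simp: bij_betw_def)
  have "\<exists>c. f (v j) = c *\<^sub>R v j" for j
    using v B by (auto simp: bij_betw_def)
  then obtain c where c: "\<And>j. f (v j) = c j *\<^sub>R v j" by metis
  define \<sigma> where "\<sigma> = (\<chi> j. norm (A *v v j))"
  have Av: "(A *v v i) \<bullet> (A *v v j) = (if i = j then (\<sigma> $ j)\<^sup>2 else 0)" for i j
  proof (cases "i = j")
    case False
    then show ?thesis
      using ov unfolding f[symmetric] c by (simp add: orthonormal_family_def)
  qed (simp add: \<sigma>_def dot_square_norm)
  have "orthonormal_family (\<lambda>j. (A *v v j) /\<^sub>R \<sigma> $ j) {j. \<sigma> $ j \<noteq> 0}"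
    by (auto simp: orthonormal_family_def Av power2_eq_square field_simps)
  then obtain u where u: "orthonormal_family u UNIV"
      "\<And>j. \<sigma> $ j \<noteq> 0 \<Longrightarrow> u j = (A *v v j) /\<^sub>R \<sigma> $ j"
    using orthonormal_family_extend[where 'a = "real^'m"] card by fastforce
  have Au: "A *v v j = \<sigma> $ j *\<^sub>R u j" for j
    using u(2)[of j] by (cases "\<sigma> $ j = 0") (simp_all, simp add: \<sigma>_def)
  define U where "U = (\<chi> i j. u j $ i)"
  define V where "V = (\<chi> i j. v j $ i)"
  have U: "transpose U ** U = mat 1" and V: "orthogonal_matrix V"
    using orthonormal_family_matrix u(1) ov by (simp_all add: U_def V_def orthogonal_matrix)
  have "A ** V = U ** diag_mat \<sigma>"
  proof -
    have "(A ** V) $ i $ j = (A *v v j) $ i" for i j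
      by (simp add: V_def matrix_matrix_mult_def matrix_vector_mult_def)
    then show ?thesis
      by (simp add: vec_eq_iff diag_mat_mult_right Au) (simp add: U_def)
  qed
  then have "A = U ** diag_mat \<sigma> ** transpose V"
    using V by (metis matrix_mul_assoc matrix_mul_rid orthogonal_matrix_def)
  then have "is_compact_svd A U \<sigma> V"
    using U V by (simp add: is_compact_svd_def \<sigma>_def)
  then show ?thesis by blast
qed

subsection \<open>Orthonormal frames and principal angles\<close>

lemma stiefel_iff: "Y \<in> stiefel \<longleftrightarrow> transpose Y ** Y = mat 1"
  by (simp add: stiefel_def)

lemma stiefel_card_le:
  fixes Y :: "real^'r^'m"
  assumes "Y \<in> stiefel"
  shows "CARD('r) \<le> CARD('m)"
proof -
  have "inj ((*v) Y)"
    unfolding matrix_left_invertible_injective[symmetric] using assms stiefel_iff by blast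
  then show ?thesis
    using dim_image_eq[of "(*v) Y" UNIV] dim_subset_UNIV[of "(*v) Y ` UNIV"] by simp
qed

lemma stiefel_mult_orthogonal:
  assumes "Y \<in> stiefel" "transpose R ** R = mat 1"
  shows "Y ** R \<in> stiefel"
proof -
  have "transpose (Y ** R) ** (Y ** R) = transpose R ** (transpose Y ** Y) ** R"
    by (simp only: matrix_transpose_mul matrix_mul_assoc)
  then show ?thesis
    using assms by (simp add: stiefel_iff)
qed

text \<open>\<open>W ** transpose W\<close> is the orthogonal projection onto the span of
  \<open>W\<close> and so fixes all columns of \<open>Y\<close>.\<close>

lemma col_span_eq_imp_factor:
  fixes Y :: "real^'r^'m" and W :: "real^'s^'m"
  assumes "W \<in> stiefel" "col_span Y \<subseteq> col_span W"
  shows "W ** (transpose W ** Y) = Y"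
proof -
  have "W *v (transpose W *v (Y *v x)) = Y *v x" for x
  proof -
    obtain z where "Y *v x = W *v z"
      using assms(2) by (auto simp: col_span_eq_range image_subset_iff)
    moreover have "transpose W *v (W *v z) = z"
      using assms(1) unfolding matrix_vector_mul_assoc stiefel_iff by simp
    ultimately show ?thesis by simp
  qed
  then show ?thesis
    unfolding matrix_eq by (simp add: matrix_vector_mul_assoc[symmetric])
qed

lemma col_span_mult_subset: "col_span (Y ** N) \<subseteq> col_span Y" for Y :: "real^'r^'m"
  by (auto simp: col_span_eq_range matrix_vector_mul_assoc[symmetric])

lemma col_span_mult_right_inverse:
  fixes Y :: "real^'r^'m"
  assumes "N ** N' = mat 1"
  shows "col_span (Y ** N) = col_span Y"
proof
  have "Y ** N ** N' = Y"
    using assms by (simp add: matrix_mul_assoc[symmetric])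
  then show "col_span Y \<subseteq> col_span (Y ** N)"
    using col_span_mult_subset[of "Y ** N" N'] by simp
qed (rule col_span_mult_subset)

lemma col_span_eq_imp_orthogonal:
  fixes Y W :: "real^'r^'m"
  assumes "Y \<in> stiefel" "W \<in> stiefel" "col_span Y = col_span W"
  shows "orthogonal_matrix (transpose W ** Y)" "Y = W ** (transpose W ** Y)"
proof -
  show eq: "Y = W ** (transpose W ** Y)"
    by (rule col_span_eq_imp_factor[OF assms(2), symmetric]) (simp add: assms(3))
  have "transpose (transpose W ** Y) ** (transpose W ** Y) = transpose Y ** (W ** (transpose W ** Y))"
    by (simp only: matrix_transpose_mul transpose_transpose matrix_mul_assoc)
  then show "orthogonal_matrix (transpose W ** Y)"
    using assms(1) unfolding eq[symmetric] orthogonal_matrix stiefel_iff by simp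
qed

lemma gr_rep_stiefel:
  fixes Y :: "real^'r^'m"
  assumes "Y \<in> stiefel"
  shows "(gr_rep (col_span Y) :: real^'r^'m) \<in> stiefel" "col_span (gr_rep (col_span Y) :: real^'r^'m) = col_span Y"
  unfolding gr_rep_def
  by (rule someI2_ex; use assms in blast)+

text \<open>Pythagoras: the residual of the projection is orthogonal to the span of
  \<open>W\<close>. Hence \<open>transpose W ** Y\<close> is the best choice of \<open>M\<close>,
  while \<open>M = 0\<close> splits the norm of \<open>Y\<close> itself.\<close>

lemma norm_residual_power2:
  fixes Y :: "real^'p^'m" and W :: "real^'r^'m"
  assumes "W \<in> stiefel"
  shows "(norm (Y - W ** M))\<^sup>2 = (norm (Y - W ** (transpose W ** Y)))\<^sup>2 + (norm (transpose W ** Y - M))\<^sup>2"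
proof -
  let ?R = "Y - W ** (transpose W ** Y)"
  have W: "transpose W ** W = mat 1" using assms by (simp add: stiefel_iff)
  have "transpose W ** ?R = 0"
    by (simp add: matrix_bilinear matrix_mul_assoc W)
  then have "(W ** (transpose W ** Y - M)) \<bullet> ?R = 0"
    by (simp add: inner_matrix_mult_left)
  then have "orthogonal ?R (W ** (transpose W ** Y - M))"
    by (simp add: orthogonal_def inner_commute)
  moreover have "Y - W ** M = ?R + W ** (transpose W ** Y - M)"
    by (simp add: matrix_bilinear)
  ultimately show ?thesis
    by (metis norm_add_Pythagorean norm_isometry_mult[OF W])
qed

text \<open>By Taylor, \<open>x - sin x\<close> is at most \<open>x ^ 3 / 6\<close>, and this is at
  most \<open>x / 2\<close> because the square of \<open>x\<close> is at most 3 on this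
  range.\<close>

lemma le_two_sin:
  fixes x :: real
  assumes "0 \<le> x" "x \<le> pi / 2"
  shows "x \<le> 2 * sin x"
proof -
  have "\<bar>sin x - x\<bar> \<le> \<bar>x\<bar> ^ 3 / 6"
    using Maclaurin_sin_bound[of x 3]
    by (simp add: sin_coeff_def fact_numeral numeral_3_eq_3 lessThan_Suc)
  then have "x - sin x \<le> x ^ 3 / 6"
    using assms abs_ge_minus_self[of "sin x - x"] by (simp add: field_simps)
  also have "x ^ 3 = x * x\<^sup>2"
    by (simp add: power3_eq_cube power2_eq_square)
  finally have "x - sin x \<le> x * x\<^sup>2 / 6" .
  moreover have "x * x\<^sup>2 \<le> x * 3"
  proof (intro mult_left_mono)
    have "x \<le> 17 / 10" using assms pi_less_4 pi_approx by simp
    then have "x\<^sup>2 \<le> (17 / 10)\<^sup>2" using assms by (intro power_mono) auto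
    then show "x\<^sup>2 \<le> 3" by (simp add: power2_eq_square)
  qed (use assms in simp)
  ultimately show ?thesis by simp
qed

text \<open>Justifies the choice in \<open>gr_dist\<close>. The angles are the arccosines of the
  singular values of \<open>transpose Y\<^sub>0 ** Y\<^sub>1\<close>.\<close>

lemma principal_angles_exist:
  fixes Y\<^sub>0 Y\<^sub>1 :: "real^'r^'m"
  assumes "Y\<^sub>0 \<in> stiefel" "Y\<^sub>1 \<in> stiefel"
  shows "\<exists>\<theta> :: real^'r. principal_angles (col_span Y\<^sub>0) (col_span Y\<^sub>1) \<theta>"
proof -
  obtain U \<sigma> V where svd: "is_compact_svd (transpose Y\<^sub>0 ** Y\<^sub>1) U \<sigma> V"
    using compact_svd_exists[of "transpose Y\<^sub>0 ** Y\<^sub>1"] by auto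
  then have U: "transpose U ** U = mat 1" and V: "orthogonal_matrix V"
    and A: "transpose Y\<^sub>0 ** Y\<^sub>1 = U ** diag_mat \<sigma> ** transpose V" and \<sigma>: "\<And>j. 0 \<le> \<sigma> $ j"
    by (auto simp: is_compact_svd_def)
  have "Y\<^sub>0 ** U \<in> stiefel" "Y\<^sub>1 ** V \<in> stiefel"
    using assms U V by (auto intro!: stiefel_mult_orthogonal simp: orthogonal_matrix)
  moreover have "transpose (Y\<^sub>0 ** U) ** (Y\<^sub>1 ** V) = diag_mat \<sigma>"
  proof -
    have "transpose (Y\<^sub>0 ** U) ** (Y\<^sub>1 ** V) = transpose U ** (transpose Y\<^sub>0 ** Y\<^sub>1) ** V"
      by (simp add: matrix_transpose_mul matrix_mul_assoc)
    also have "\<dots> = (transpose U ** U) ** diag_mat \<sigma> ** (transpose V ** V)"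
      unfolding A by (simp only: matrix_mul_assoc)
    finally show ?thesis
      using U V by (simp add: orthogonal_matrix)
  qed
  \<comment> \<open>In the rotated frames the singular values are inner products of unit columns,
    hence at most 1.\<close>
  ultimately have \<sigma>1: "\<sigma> $ j \<le> 1" for j
  proof -
    let ?P = "Y\<^sub>0 ** U" and ?Q = "Y\<^sub>1 ** V"
    assume P: "?P \<in> stiefel" and Q: "?Q \<in> stiefel" and PQ: "transpose ?P ** ?Q = diag_mat \<sigma>"
    have "\<sigma> $ j = column j ?P \<bullet> column j ?Q"
      using arg_cong[OF PQ, of "\<lambda>A. A $ j $ j"]
      by (simp add: matrix_mult_component diag_mat_def) (simp add: transpose_def column_def)
    also have "\<dots> \<le> norm (column j ?P) * norm (column j ?Q)"
      by (rule norm_cauchy_schwarz)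
    also have "\<dots> = 1"
      using P Q by (simp add: stiefel_iff matrix_mult_transpose_dot_column vec_eq_iff mat_def norm_eq_sqrt_inner)
    finally show ?thesis .
  qed
  define \<theta> where "\<theta> = (\<chi> j. arccos (\<sigma> $ j))"
  have "(\<chi> j. cos (\<theta> $ j)) = \<sigma>"
    using \<sigma> \<sigma>1 by (simp add: \<theta>_def vec_eq_iff cos_arccos order.trans[of "-1" 0])
  moreover have "0 \<le> \<theta> $ j \<and> \<theta> $ j \<le> pi / 2" for j
    using \<sigma>[of j] \<sigma>1[of j] arccos_le_pi2[of "\<sigma> $ j"] by (simp add: \<theta>_def arccos_lbound)
  ultimately have "principal_angles (col_span Y\<^sub>0) (col_span Y\<^sub>1) \<theta>"
    using assms svd unfolding principal_angles_def by metis
  then show ?thesis ..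
qed

text \<open>The squared norm of \<open>transpose W ** Y\<close> is the sum of the squared cosines
  and that of \<open>Y\<close> is r, so the minimal residual has the sum of the squared sines as its
  square. The factor 2 comes from \<open>le_two_sin\<close>.\<close>

lemma gr_dist_le_residual:
  fixes Y W :: "real^'r^'m"
  assumes Y: "Y \<in> stiefel" and W: "W \<in> stiefel"
  shows "gr_dist TYPE('r) (col_span Y) (col_span W) \<le> 2 * norm (Y - W ** M)"
proof -
  define \<theta> where "\<theta> = (SOME \<theta> :: real^'r. principal_angles (col_span Y) (col_span W) \<theta>)"
  have pa: "principal_angles (col_span Y) (col_span W) \<theta>"
    unfolding \<theta>_def using principal_angles_exist[OF Y W] by (rule someI_ex)
  have \<theta>: "0 \<le> \<theta> $ j" "\<theta> $ j \<le> pi / 2" for j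
    using conjunct1[OF pa[unfolded principal_angles_def]] by auto
  obtain Y' W' :: "real^'r^'m" and U V :: "real^'r^'r"
    where YW': "Y' \<in> stiefel" "W' \<in> stiefel" "col_span Y' = col_span Y" "col_span W' = col_span W"
      and svd: "is_compact_svd (transpose Y' ** W') U (\<chi> j. cos (\<theta> $ j)) V"
    using pa unfolding principal_angles_def by (elim conjE exE) (rule that)
  define c where "c = (\<chi> j. cos (\<theta> $ j))"
  have nc: "norm (transpose Y' ** W') = norm c"
  proof -
    have "transpose Y' ** W' = U ** diag_mat c ** transpose V"
      and U: "transpose U ** U = mat 1" and V: "transpose V ** V = mat 1"
      using svd by (simp_all add: is_compact_svd_def c_def orthogonal_matrix)
    then show ?thesis
      by (simp only: norm_mult_isometry_transpose[OF V] norm_isometry_mult[OF U] norm_diag_mat)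
  qed
  \<comment> \<open>The angles were obtained from other representatives \<open>Y'\<close>,
    \<open>W'\<close>. These differ from \<open>Y\<close>, \<open>W\<close> by orthogonal factors,
    which leave the Frobenius norm unchanged.\<close>
  have "norm (transpose W ** Y) = norm (transpose Y' ** W')"
  proof -
    let ?R = "transpose W ** W'" and ?Q = "transpose Y ** Y'"
    have R: "orthogonal_matrix ?R" "W' = W ** ?R"
      using col_span_eq_imp_orthogonal[OF YW'(2) W YW'(4)] .
    have Q: "orthogonal_matrix ?Q" "Y' = Y ** ?Q"
      using col_span_eq_imp_orthogonal[OF YW'(1) Y YW'(3)] .
    have RT: "transpose (transpose ?R) ** transpose ?R = mat 1"
      and QT: "transpose (transpose ?Q) ** transpose ?Q = mat 1"
      using R(1) Q(1) by (simp_all only: transpose_transpose orthogonal_matrix_def)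
    have "transpose W' ** Y' = transpose (W ** ?R) ** (Y ** ?Q)"
      using R(2) Q(2) by simp
    also have "\<dots> = transpose ?R ** (transpose W ** Y) ** transpose (transpose ?Q)"
      by (simp only: matrix_transpose_mul matrix_mul_assoc transpose_transpose)
    finally have "norm (transpose W' ** Y') = norm (transpose W ** Y)"
      by (simp only: norm_mult_isometry_transpose[OF QT] norm_isometry_mult[OF RT])
    then show ?thesis
      by (metis matrix_transpose_mul norm_transpose transpose_transpose)
  qed
  then have nWY: "(norm (transpose W ** Y))\<^sup>2 = (\<Sum>j\<in>UNIV. (cos (\<theta> $ j))\<^sup>2)"
    by (simp add: nc norm_vec_power2 c_def)
  have "real CARD('r) = (norm Y)\<^sup>2"
    using norm_stiefel[OF Y] by simp
  also have "\<dots> = (norm (Y - W ** (transpose W ** Y)))\<^sup>2 + (\<Sum>j\<in>UNIV. (cos (\<theta> $ j))\<^sup>2)"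
    using norm_residual_power2[OF W, of Y 0] nWY by simp
  finally have "(norm (Y - W ** (transpose W ** Y)))\<^sup>2 = (\<Sum>j\<in>UNIV. 1 - (cos (\<theta> $ j))\<^sup>2)"
    by (simp add: sum_subtractf)
  then have sin: "(\<Sum>j\<in>UNIV. (sin (\<theta> $ j))\<^sup>2) \<le> (norm (Y - W ** M))\<^sup>2"
    using norm_residual_power2[OF W, of Y M] by (simp add: sin_squared_eq)
  have "(\<Sum>j\<in>UNIV. (\<theta> $ j)\<^sup>2) \<le> (\<Sum>j\<in>UNIV. (2 * sin (\<theta> $ j))\<^sup>2)"
    using \<theta> by (intro sum_mono power_mono le_two_sin)
  also have "\<dots> \<le> (2 * norm (Y - W ** M))\<^sup>2"
    using sin by (simp add: power_mult_distrib sum_distrib_left[symmetric])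
  finally have "sqrt (\<Sum>j\<in>UNIV. (\<theta> $ j)\<^sup>2) \<le> 2 * norm (Y - W ** M)"
    by (simp add: real_le_lsqrt sum_nonneg)
  then show ?thesis
    by (simp add: gr_dist_def \<theta>_def[symmetric])
qed

subsection \<open>Charts and the exponential map\<close>

text \<open>The square factor \<open>R\<close> with \<open>W = Y ** R\<close> satisfies
  \<open>transpose R ** R = mat 1\<close> and is therefore invertible.\<close>

lemma col_span_subset_imp_eq:
  fixes Y W :: "real^'r^'m"
  assumes "Y \<in> stiefel" "W \<in> stiefel" "col_span W \<subseteq> col_span Y"
  shows "col_span W = col_span Y"
proof -
  let ?R = "transpose Y ** W"
  have eq: "W = Y ** ?R"
    by (rule col_span_eq_imp_factor[OF assms(1,3), symmetric])
  have "transpose ?R ** ?R = transpose W ** (Y ** ?R)"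
    by (simp only: matrix_transpose_mul transpose_transpose matrix_mul_assoc)
  then have "transpose ?R ** ?R = mat 1"
    using assms(2) unfolding eq[symmetric] stiefel_iff by simp
  then have "?R ** transpose ?R = mat 1"
    by (rule matrix_left_right_inverse[THEN iffD1])
  then show ?thesis
    using col_span_mult_right_inverse eq by metis
qed

text \<open>\<open>Z\<close> is the frame of the subspace normalised by
  \<open>transpose Y\<^sub>0 ** Z = mat 1\<close>. It depends smoothly on the curve parameter where
  the chart expression does, unlike the arbitrary \<open>gr_rep\<close>, and the factors give the
  passage to and from any orthonormal frame.\<close>

lemma gr_chart_frame:
  fixes Y Y\<^sub>0 :: "real^'r^'m"
  assumes Y: "Y \<in> stiefel" and dom: "col_span Y \<in> gr_chart_domain Y\<^sub>0"
  defines "Z \<equiv> Y\<^sub>0 + gr_chart Y\<^sub>0 (col_span Y)"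
  shows "Z ** (transpose Y\<^sub>0 ** Y) = Y" "Y ** (transpose Y ** Z) = Z" "transpose Y\<^sub>0 ** Z = mat 1"
proof -
  define G :: "real^'r^'m" where "G = gr_rep (col_span Y)"
  have G: "G \<in> stiefel" "col_span G = col_span Y"
    using gr_rep_stiefel[OF Y] by (simp_all add: G_def)
  obtain Y' :: "real^'r^'m" where Y': "Y' \<in> stiefel" "col_span Y = col_span Y'" "invertible (transpose Y\<^sub>0 ** Y')"
    using dom unfolding gr_chart_domain_def by blast
  \<comment> \<open>The chart uses the representative \<open>G\<close>, whereas the domain gives
    invertibility for some \<open>Y'\<close>. The orthogonal factor between the two transfers
    it.\<close>
  let ?R = "transpose Y' ** G"
  have R: "orthogonal_matrix ?R" "G = Y' ** ?R"
    using col_span_eq_imp_orthogonal[OF G(1) Y'(1)] G Y' by simp_all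
  have "invertible ?R"
    using R(1) unfolding orthogonal_matrix_def invertible_def by blast
  moreover have "transpose Y\<^sub>0 ** G = transpose Y\<^sub>0 ** Y' ** ?R"
    by (subst R(2)) (simp only: matrix_mul_assoc)
  ultimately have inv: "invertible (transpose Y\<^sub>0 ** G)"
    using Y'(3) by (simp add: invertible_mult)
  define J where "J = matrix_inv (transpose Y\<^sub>0 ** G)"
  have J: "J ** (transpose Y\<^sub>0 ** G) = mat 1" "(transpose Y\<^sub>0 ** G) ** J = mat 1"
    using someI_ex[OF inv[unfolded invertible_def]] by (simp_all add: J_def matrix_inv_def)
  have Z: "Z = G ** J"
    by (simp add: Z_def gr_chart_def Let_def G_def J_def)
  let ?Q = "transpose G ** Y"
  have Q: "Y = G ** ?Q"
    using col_span_eq_imp_orthogonal(2)[OF Y G(1)] G by simp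
  have "Z ** (transpose Y\<^sub>0 ** Y) = G ** J ** (transpose Y\<^sub>0 ** (G ** ?Q))"
    using Q Z by simp
  also have "\<dots> = G ** (J ** (transpose Y\<^sub>0 ** G)) ** ?Q"
    by (simp only: matrix_mul_assoc)
  also have "\<dots> = Y"
    using Q J by simp
  finally show "Z ** (transpose Y\<^sub>0 ** Y) = Y" .
  show "Y ** (transpose Y ** Z) = Z"
    by (rule col_span_eq_imp_factor[OF Y]) (metis Z G(2) col_span_mult_subset)
  show "transpose Y\<^sub>0 ** Z = mat 1"
    using J(2) Z by (simp add: matrix_mul_assoc)
qed

text \<open>If \<open>V diag(\<sigma>\<^sup>2) V\<^sup>T = V' diag(\<sigma>'\<^sup>2) V'\<^sup>T\<close>, then \<open>R = V\<^sup>T V'\<close> satisfies \<open>R\<^sub>i\<^sub>j = 0\<close> unless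
  \<open>\<sigma>\<^sub>i = \<sigma>'\<^sub>j\<close>, so \<open>R\<close> intertwines \<open>diag(g(\<sigma>))\<close> and \<open>diag(g(\<sigma>'))\<close> for every function \<open>g\<close>.\<close>

lemma svd_function_right_unique:
  assumes svd: "is_compact_svd A U \<sigma> V" and svd': "is_compact_svd A U' \<sigma>' V'"
  shows "V ** diag_mat (\<chi> j. g (\<sigma> $ j)) ** transpose V = V' ** diag_mat (\<chi> j. g (\<sigma>' $ j)) ** transpose V'"
proof -
  \<comment> \<open>Both decompositions diagonalise \<open>transpose A ** A\<close>; this is the
    equation from which the intertwining argument starts.\<close>
  have gram: "transpose A ** A = V ** diag_mat (\<chi> j. \<sigma> $ j * \<sigma> $ j) ** transpose V"
    if "is_compact_svd A U \<sigma> V" for U \<sigma> V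
  proof -
    have U: "transpose U ** U = mat 1" and A: "A = U ** diag_mat \<sigma> ** transpose V"
      using that by (auto simp: is_compact_svd_def)
    have "transpose A ** A = V ** diag_mat \<sigma> ** (transpose U ** U) ** diag_mat \<sigma> ** transpose V"
      unfolding A by (simp only: matrix_transpose_mul transpose_transpose transpose_diag_mat matrix_mul_assoc)
    also have "\<dots> = V ** (diag_mat \<sigma> ** diag_mat \<sigma>) ** transpose V"
      by (simp only: U matrix_mul_rid matrix_mul_assoc)
    finally show ?thesis by (simp add: diag_mat_mult)
  qed
  have V: "transpose V ** V = mat 1" "V ** transpose V = mat 1"
    and V': "transpose V' ** V' = mat 1" "V' ** transpose V' = mat 1"
    and \<sigma>: "\<And>j. 0 \<le> \<sigma> $ j" and \<sigma>': "\<And>j. 0 \<le> \<sigma>' $ j"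
    using svd svd' by (auto simp: is_compact_svd_def orthogonal_matrix_def)
  define R where "R = transpose V ** V'"
  have "diag_mat (\<chi> j. \<sigma> $ j * \<sigma> $ j) ** R = R ** diag_mat (\<chi> j. \<sigma>' $ j * \<sigma>' $ j)"
  proof -
    let ?D = "diag_mat (\<chi> j. \<sigma> $ j * \<sigma> $ j)" and ?D' = "diag_mat (\<chi> j. \<sigma>' $ j * \<sigma>' $ j)"
    have eq: "V ** ?D ** transpose V = V' ** ?D' ** transpose V'"
      using gram[OF svd] gram[OF svd'] by simp
    have "?D ** R = (transpose V ** V) ** ?D ** transpose V ** V'"
      by (simp add: V R_def matrix_mul_assoc)
    also have "\<dots> = transpose V ** (V ** ?D ** transpose V) ** V'"
      by (simp only: matrix_mul_assoc)
    also have "\<dots> = R ** ?D' ** (transpose V' ** V')"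
      unfolding eq R_def by (simp only: matrix_mul_assoc)
    finally show ?thesis by (simp add: V')
  qed
  then have "\<sigma> $ i * \<sigma> $ i * R $ i $ j = R $ i $ j * (\<sigma>' $ j * \<sigma>' $ j)" for i j
    unfolding vec_eq_iff diag_mat_mult_left diag_mat_mult_right by simp
  then have "R $ i $ j = 0 \<or> (\<sigma> $ i)\<^sup>2 = (\<sigma>' $ j)\<^sup>2" for i j
    by (simp add: power2_eq_square mult.commute)
  then have "R $ i $ j = 0 \<or> \<sigma> $ i = \<sigma>' $ j" for i j
    using \<sigma> \<sigma>' by (simp add: power2_eq_iff_nonneg)
  then have "g (\<sigma> $ i) * R $ i $ j = R $ i $ j * g (\<sigma>' $ j)" for i j
    by (metis mult.commute mult_zero_right)
  then have RD: "diag_mat (\<chi> j. g (\<sigma> $ j)) ** R = R ** diag_mat (\<chi> j. g (\<sigma>' $ j))"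
    unfolding vec_eq_iff diag_mat_mult_left diag_mat_mult_right by simp
  let ?D = "diag_mat (\<chi> j. g (\<sigma> $ j))" and ?D' = "diag_mat (\<chi> j. g (\<sigma>' $ j))"
  have "V ** ?D ** transpose V = V ** ?D ** transpose V ** (V' ** transpose V')"
    by (simp add: V')
  also have "\<dots> = V ** (?D ** R) ** transpose V'"
    by (simp only: R_def matrix_mul_assoc)
  also have "\<dots> = (V ** transpose V) ** V' ** ?D' ** transpose V'"
    unfolding RD by (simp only: R_def matrix_mul_assoc)
  finally show ?thesis by (simp add: V)
qed

text \<open>Writing \<open>g(\<sigma>)\<close> as \<sigma> times
  \<open>g(\<sigma>) / \<sigma>\<close> pulls out the factor \<open>A\<close> and leaves a function
  on the right side. Where \<sigma> vanishes, the quotient is 0 by convention, which is consistent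
  since \<open>g 0 = 0\<close>.\<close>

lemma svd_function_left_unique:
  assumes svd: "is_compact_svd A U \<sigma> V" and svd': "is_compact_svd A U' \<sigma>' V'" and "g 0 = 0"
  shows "U ** diag_mat (\<chi> j. g (\<sigma> $ j)) ** transpose V = U' ** diag_mat (\<chi> j. g (\<sigma>' $ j)) ** transpose V'"
proof -
  have factor: "U ** diag_mat (\<chi> j. g (\<sigma> $ j)) ** transpose V =
      A ** (V ** diag_mat (\<chi> j. g (\<sigma> $ j) / \<sigma> $ j) ** transpose V)"
    if "is_compact_svd A U \<sigma> V" for U \<sigma> V
  proof -
    have V: "transpose V ** V = mat 1" and A: "A = U ** diag_mat \<sigma> ** transpose V"
      using that by (auto simp: is_compact_svd_def orthogonal_matrix_def)
    have "A ** (V ** diag_mat (\<chi> j. g (\<sigma> $ j) / \<sigma> $ j) ** transpose V) =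
        U ** diag_mat \<sigma> ** (transpose V ** V) ** diag_mat (\<chi> j. g (\<sigma> $ j) / \<sigma> $ j) ** transpose V"
      unfolding A by (simp only: matrix_mul_assoc)
    also have "\<dots> = U ** (diag_mat \<sigma> ** diag_mat (\<chi> j. g (\<sigma> $ j) / \<sigma> $ j)) ** transpose V"
      by (simp only: V matrix_mul_rid matrix_mul_assoc)
    also have "diag_mat \<sigma> ** diag_mat (\<chi> j. g (\<sigma> $ j) / \<sigma> $ j) = diag_mat (\<chi> j. g (\<sigma> $ j))"
      unfolding diag_mat_mult using \<open>g 0 = 0\<close>
      by (intro arg_cong[where f = diag_mat]) (auto simp: vec_eq_iff)
    finally show ?thesis by simp
  qed
  show ?thesis
    unfolding factor[OF svd] factor[OF svd']
    by (intro arg_cong[where f = "(**) A"] svd_function_right_unique[OF svd svd'])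
qed

lemma some_compact_svd:
  assumes "is_compact_svd A U\<^sub>0 \<sigma>\<^sub>0 V\<^sub>0"
  obtains U \<sigma> V where "(SOME (U, \<sigma>, V). is_compact_svd A U \<sigma> V) = (U, \<sigma>, V)" "is_compact_svd A U \<sigma> V"
proof -
  obtain U \<sigma> V where some: "(SOME (U, \<sigma>, V). is_compact_svd A U \<sigma> V) = (U, \<sigma>, V)"
    by (metis prod_cases3)
  have "case (SOME (U, \<sigma>, V). is_compact_svd A U \<sigma> V) of (U, \<sigma>, V) \<Rightarrow> is_compact_svd A U \<sigma> V"
    by (rule someI[of _ "(U\<^sub>0, \<sigma>\<^sub>0, V\<^sub>0)"]) (simp add: assms)
  then have "is_compact_svd A U \<sigma> V"
    unfolding some by simp
  with some show thesis by (rule that)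
qed

text \<open>Frees \<open>gr_exp\<close> from the chosen decomposition. Right multiplication by
  \<open>transpose V\<close> keeps the span and turns both summands into functions of \<Delta>
  alone, by the two uniqueness lemmas.\<close>

lemma gr_exp_svd:
  fixes Y :: "real^'r^'m"
  assumes svd: "is_compact_svd \<Delta> U \<theta> V"
  shows "gr_exp Y \<Delta> =
    col_span (Y ** V ** diag_mat (\<chi> j. cos (\<theta> $ j)) + U ** diag_mat (\<chi> j. sin (\<theta> $ j)))"
proof -
  obtain U' \<theta>' V' where some: "(SOME (U, \<theta>, V). is_compact_svd \<Delta> U \<theta> V) = (U', \<theta>', V')"
    and svd': "is_compact_svd \<Delta> U' \<theta>' V'"
    using svd by (rule some_compact_svd)
  define X where "X U \<theta> V = Y ** (V ** diag_mat (\<chi> j. cos (\<theta> $ j)) ** transpose V)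
      + U ** diag_mat (\<chi> j. sin (\<theta> $ j)) ** transpose V"
    for U :: "real^'r^'m" and \<theta> :: "real^'r" and V :: "real^'r^'r"
  have span: "col_span (Y ** V ** diag_mat (\<chi> j. cos (\<theta> $ j)) + U ** diag_mat (\<chi> j. sin (\<theta> $ j))) = col_span (X U \<theta> V)"
    if "is_compact_svd \<Delta> U \<theta> V" for U \<theta> V
  proof -
    have V: "transpose V ** V = mat 1"  "V ** transpose V = mat 1"
      using that by (auto simp: is_compact_svd_def orthogonal_matrix_def)
    have "X U \<theta> V = (Y ** V ** diag_mat (\<chi> j. cos (\<theta> $ j)) + U ** diag_mat (\<chi> j. sin (\<theta> $ j))) ** transpose V"
      unfolding X_def by (simp only: matrix_add_left matrix_mul_assoc)
    then show ?thesis
      by (simp only: col_span_mult_right_inverse[OF V(1)])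
  qed
  have "X U \<theta> V = X U' \<theta>' V'"
    unfolding X_def
    using svd_function_right_unique[OF svd svd', of cos] svd_function_left_unique[OF svd svd', of sin] by simp
  then show ?thesis
    unfolding gr_exp_def some prod.case span[OF svd] span[OF svd'] by simp
qed

subsection \<open>Geodesic interpolation\<close>

lemma abs_sin_diff_le: "\<bar>sin x - x\<bar> \<le> x\<^sup>2 / 2" for x :: real
  using Maclaurin_sin_bound[of x 2]
  by (simp add: sin_coeff_def numeral_2_eq_2 lessThan_Suc)

lemma one_minus_cos_le_sin_power2:
  fixes x :: real
  assumes "0 \<le> x" "x \<le> pi / 2"
  shows "1 - cos x \<le> (sin x)\<^sup>2"
proof -
  have "0 \<le> cos x" using assms by (simp add: cos_ge_zero)
  then have "(cos x)\<^sup>2 \<le> cos x" by (simp add: power2_eq_square mult_left_le)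
  then show ?thesis by (simp add: sin_squared_eq)
qed

text \<open>Both \<open>cos (t * x)\<close> and the chord lie between \<open>cos x\<close> and 1.
  The bound is in terms of the sine because the sines of the angles measure the residual of the end
  frames in \<open>glerp_frame\<close>.\<close>

lemma cos_chord_error:
  fixes x t :: real
  assumes x: "0 \<le> x" "x \<le> pi / 2" and t: "0 \<le> t" "t \<le> 1"
  shows "\<bar>cos (t * x) - ((1 - t) + t * cos x)\<bar> \<le> (sin x)\<^sup>2"
proof -
  have "t * x \<le> x" using x t by (simp add: mult_left_le_one_le)
  then have "cos x \<le> cos (t * x)"
    using x t by (intro cos_monotone_0_pi_le) auto
  moreover have "0 \<le> t * (1 - cos x)" "t * (1 - cos x) \<le> 1 - cos x"
    using t by (auto simp: mult_left_le_one_le)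
  moreover have "cos (t * x) \<le> 1" by simp
  ultimately have "\<bar>cos (t * x) - 1 + t * (1 - cos x)\<bar> \<le> 1 - cos x"
    unfolding abs_le_iff by linarith
  then show ?thesis
    using one_minus_cos_le_sin_power2[OF x] by (simp add: algebra_simps)
qed

text \<open>The linear parts cancel, leaving two remainders of at most half the square of
  \<open>x\<close> each; \<open>le_two_sin\<close> turns that square into 4 times the squared
  sine.\<close>

lemma sin_chord_error:
  fixes x t :: real
  assumes x: "0 \<le> x" "x \<le> pi / 2" and t: "0 \<le> t" "t \<le> 1"
  shows "\<bar>sin (t * x) - t * sin x\<bar> \<le> 4 * (sin x)\<^sup>2"
proof -
  have "\<bar>sin (t * x) - t * sin x\<bar> \<le> \<bar>sin (t * x) - t * x\<bar> + \<bar>t * (sin x - x)\<bar>"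
    using abs_triangle_ineq4[of "sin (t * x) - t * x" "t * (sin x - x)"]
    by (simp add: algebra_simps)
  also have "\<bar>t * (sin x - x)\<bar> = t * \<bar>sin x - x\<bar>"
    using t by (simp add: abs_mult)
  also have "\<bar>sin (t * x) - t * x\<bar> + t * \<bar>sin x - x\<bar> \<le> (t * x)\<^sup>2 / 2 + 1 * (x\<^sup>2 / 2)"
    using t by (intro add_mono mult_mono abs_sin_diff_le) auto
  also have "(t * x)\<^sup>2 \<le> x\<^sup>2"
    using x t by (intro power_mono) (auto simp: mult_left_le_one_le)
  finally have "\<bar>sin (t * x) - t * sin x\<bar> \<le> x\<^sup>2" by simp
  also have "x\<^sup>2 \<le> (2 * sin x)\<^sup>2"
    using x le_two_sin[OF x] by (intro power_mono) auto
  finally show ?thesis by (simp add: power_mult_distrib)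
qed

lemma norm_le_power2_norm:
  fixes x y :: "real^'n"
  assumes "\<And>j. \<bar>x $ j\<bar> \<le> c * (y $ j)\<^sup>2"
  shows "norm x \<le> c * (norm y)\<^sup>2"
proof -
  have "norm x \<le> (\<Sum>j\<in>UNIV. \<bar>x $ j\<bar>)" by (rule norm_le_l1_cart)
  also have "\<dots> \<le> (\<Sum>j\<in>UNIV. c * (y $ j)\<^sup>2)" by (intro sum_mono assms)
  also have "\<dots> = c * (norm y)\<^sup>2" by (simp add: norm_vec_power2 sum_distrib_left)
  finally show ?thesis .
qed

lemma norm_diag_combination_le:
  fixes P U :: "real^'r^'m"
  assumes "transpose P ** P = mat 1" "transpose U ** U = mat 1"
  shows "norm (P ** diag_mat a + U ** diag_mat b) \<le> norm a + norm b"
  using norm_triangle_ineq[of "P ** diag_mat a" "U ** diag_mat b"]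
  by (simp add: norm_isometry_mult assms norm_diag_mat)

lemma diag_mat_diff: "diag_mat a - diag_mat b = diag_mat (a - b)"
  and diag_mat_add: "diag_mat a + diag_mat b = diag_mat (a + b)"
  and diag_mat_scaleR: "t *\<^sub>R diag_mat a = diag_mat (t *\<^sub>R a)"
  by (auto simp: diag_mat_def vec_eq_iff)

lemma diag_mat_1: "diag_mat (\<chi> j. 1) = mat 1" and diag_mat_0: "diag_mat (\<chi> j. 0) = 0"
  by (auto simp: diag_mat_def mat_def vec_eq_iff)

text \<open>The chord errors are stated in terms of the residual of \<open>W 1\<close> against
  \<open>W 0\<close>, that is, the norm of the sines of the angles, since
  \<open>frame_interpolation_error\<close> can bound this residual by the step size.\<close>

lemma glerp_frame:
  fixes Y\<^sub>0 Y\<^sub>1 :: "real^'r^'m"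
  assumes Y\<^sub>0: "Y\<^sub>0 \<in> stiefel" and Y\<^sub>1: "Y\<^sub>1 \<in> stiefel"
    and dom: "col_span Y\<^sub>1 \<in> gr_chart_domain (gr_rep (col_span Y\<^sub>0) :: real^'r^'m)"
  obtains W :: "real \<Rightarrow> real^'r^'m" where
    "\<And>\<tau>. W \<tau> \<in> stiefel"
    "\<And>\<tau>. 0 \<le> \<tau> \<Longrightarrow> glerp TYPE('r) (col_span Y\<^sub>0) (col_span Y\<^sub>1) \<tau> = col_span (W \<tau>)"
    "col_span (W 0) = col_span Y\<^sub>0" "col_span (W 1) = col_span Y\<^sub>1"
    "norm (W 1 - W 0) \<le> 2 * norm (W 1 - W 0 ** (transpose (W 0) ** W 1))"
    "\<And>\<tau>. 0 \<le> \<tau> \<Longrightarrow> \<tau> \<le> 1 \<Longrightarrow> norm (W \<tau> - ((1 - \<tau>) *\<^sub>R W 0 + \<tau> *\<^sub>R W 1)) \<le>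
       5 * (norm (W 1 - W 0 ** (transpose (W 0) ** W 1)))\<^sup>2"
proof -
  define Y :: "real^'r^'m" where "Y = gr_rep (col_span Y\<^sub>0)"
  have Y: "Y \<in> stiefel" "col_span Y = col_span Y\<^sub>0"
    using gr_rep_stiefel[OF Y\<^sub>0] by (simp_all add: Y_def)
  then have YY: "transpose Y ** Y = mat 1" by (simp add: stiefel_iff)
  define S where "S = col_span Y\<^sub>1"
  define B where "B = gr_chart Y S"
  note frame = gr_chart_frame[OF Y\<^sub>1 dom[folded Y_def], folded S_def, folded B_def]
  obtain U\<^sub>0 \<sigma>\<^sub>0 V\<^sub>0 where "is_compact_svd B U\<^sub>0 \<sigma>\<^sub>0 V\<^sub>0"
    using compact_svd_exists[of B] stiefel_card_le[OF Y(1)] by blast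
  then obtain U \<sigma> V where some: "(SOME (U, \<sigma>, V). is_compact_svd B U \<sigma> V) = (U, \<sigma>, V)"
    and svd: "is_compact_svd B U \<sigma> V"
    by (rule some_compact_svd)
  from svd have U: "transpose U ** U = mat 1" and V: "orthogonal_matrix V" "transpose V ** V = mat 1" "V ** transpose V = mat 1"
    and \<sigma>: "\<And>j. 0 \<le> \<sigma> $ j" and B: "B = U ** diag_mat \<sigma> ** transpose V"
    by (auto simp: is_compact_svd_def orthogonal_matrix_def)
  define \<theta> where "\<theta> = (\<chi> j. arctan (\<sigma> $ j))"
  have \<theta>: "0 \<le> \<theta> $ j" "\<theta> $ j \<le> pi / 2" for j
    using \<sigma>[of j] arctan_ubound[of "\<sigma> $ j"] by (simp_all add: \<theta>_def)
  define P where "P = Y ** V"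
  have P: "P \<in> stiefel"
    unfolding P_def by (rule stiefel_mult_orthogonal[OF Y(1) V(2)])
  then have PP: "transpose P ** P = mat 1" by (simp add: stiefel_iff)
  define c where "c \<tau> = (\<chi> j. cos (\<tau> * \<theta> $ j))" for \<tau>
  define s where "s \<tau> = (\<chi> j. sin (\<tau> * \<theta> $ j))" for \<tau>
  define W where "W \<tau> = P ** diag_mat (c \<tau>) + U ** diag_mat (s \<tau>)" for \<tau>

  \<comment> \<open>Columns of \<open>U\<close> for vanishing singular values need not be orthogonal
    to \<open>P\<close>. Horizontality of \<open>B\<close> controls the remaining ones, and the
    factor \<open>s \<tau>\<close> removes the others because their angle is 0.\<close>
  have PUs: "transpose P ** U ** diag_mat (s \<tau>) = 0" for \<tau>
  proof -
    have "transpose Y ** B = 0"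
      using frame(3) by (simp add: matrix_add_right YY)
    then have "transpose V ** (transpose Y ** B) ** V = 0"
      by simp
    then have "transpose P ** U ** diag_mat \<sigma> ** (transpose V ** V) = 0"
      unfolding B P_def by (simp only: matrix_transpose_mul matrix_mul_assoc)
    then have comp: "(transpose P ** U) $ i $ j * \<sigma> $ j = 0" for i j
      by (simp add: V diag_mat_mult_right[symmetric])
    have "(transpose P ** U) $ i $ j * s \<tau> $ j = 0" for i j
      using comp[of i j] by (auto simp: s_def \<theta>_def)
    then show ?thesis
      by (simp add: vec_eq_iff diag_mat_mult_right)
  qed
  have PW: "transpose P ** W \<tau> = diag_mat (c \<tau>)" for \<tau>
    using PUs[of \<tau>] by (simp add: W_def matrix_add_right matrix_mul_assoc PP)
  have WT: "transpose (W \<tau>) = diag_mat (c \<tau>) ** transpose P + diag_mat (s \<tau>) ** transpose U" for \<tau>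
  proof -
    have "transpose (A + B) = transpose A + transpose B" for A B :: "real^'r^'m"
      by (simp add: transpose_def vec_eq_iff)
    then show ?thesis
      by (simp add: W_def matrix_transpose_mul transpose_diag_mat)
  qed
  have UW: "diag_mat (s \<tau>) ** transpose U ** W \<tau> = diag_mat (s \<tau>) ** diag_mat (s \<tau>)" for \<tau>
  proof -
    have "diag_mat (s \<tau>) ** transpose U ** P = transpose (transpose P ** U ** diag_mat (s \<tau>))"
      by (simp only: matrix_transpose_mul transpose_transpose transpose_diag_mat matrix_mul_assoc)
    then have 1: "diag_mat (s \<tau>) ** transpose U ** P = 0"
      unfolding PUs by (simp add: transpose_def vec_eq_iff)
    have "diag_mat (s \<tau>) ** transpose U ** W \<tau> = (diag_mat (s \<tau>) ** transpose U ** P) ** diag_mat (c \<tau>)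
        + diag_mat (s \<tau>) ** (transpose U ** U) ** diag_mat (s \<tau>)"
      by (simp only: W_def matrix_add_right matrix_mul_assoc)
    then show ?thesis
      by (simp add: 1 U)
  qed
  have W: "W \<tau> \<in> stiefel" for \<tau>
  proof -
    have "transpose (W \<tau>) ** W \<tau> = diag_mat (c \<tau>) ** (transpose P ** W \<tau>) + diag_mat (s \<tau>) ** transpose U ** W \<tau>"
      unfolding WT by (simp only: matrix_add_left matrix_mul_assoc)
    also have "\<dots> = diag_mat (\<chi> j. 1)"
      unfolding PW UW diag_mat_mult diag_mat_add
      by (intro arg_cong[where f = diag_mat])
        (simp add: vec_eq_iff c_def s_def flip: power2_eq_square)
    finally show ?thesis
      by (simp add: stiefel_iff diag_mat_1)
  qed
  have W0: "W 0 = P"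
    by (simp add: W_def c_def s_def diag_mat_1 diag_mat_0)
  \<comment> \<open>Projecting \<open>W 1\<close> onto the span of \<open>P\<close> keeps exactly
    the cosine part.\<close>
  have resid: "W 1 - W 0 ** (transpose (W 0) ** W 1) = U ** diag_mat (s 1)"
    unfolding W0 PW by (simp add: W_def)
  have q: "norm (W 1 - W 0 ** (transpose (W 0) ** W 1)) = norm (s 1)"
    unfolding resid by (simp add: norm_isometry_mult[OF U] norm_diag_mat)

  show thesis
  proof (rule that[of W])
    show "W \<tau> \<in> stiefel" for \<tau> by (rule W)
    show "col_span (W 0) = col_span Y\<^sub>0"
      unfolding W0 P_def col_span_mult_right_inverse[OF V(3)] by (rule Y(2))
    show "glerp TYPE('r) (col_span Y\<^sub>0) (col_span Y\<^sub>1) \<tau> = col_span (W \<tau>)" if "0 \<le> \<tau>" for \<tau>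
    proof -
      have log: "gr_log Y S = U ** diag_mat \<theta> ** transpose V"
        by (simp add: gr_log_def B_def[symmetric] some \<theta>_def)
      \<comment> \<open>Scaling the logarithm scales only the angles, which stay nonnegative as
        \<open>0 \<le> \<tau>\<close>.\<close>
      have "is_compact_svd (\<tau> *\<^sub>R gr_log Y S) U (\<tau> *\<^sub>R \<theta>) V"
        unfolding is_compact_svd_def log using U V \<theta>(1) that
        by (simp add: diag_mat_scaleR[symmetric] matrix_scaleR_left matrix_scaleR_right)
      from gr_exp_svd[OF this, of Y] show ?thesis
        by (simp add: glerp_def Y_def[symmetric] S_def[symmetric] W_def P_def c_def s_def)
    qed
    show "col_span (W 1) = col_span Y\<^sub>1"
    proof (rule col_span_subset_imp_eq[OF Y\<^sub>1 W])
      \<comment> \<open>As \<sigma> is the tangent of the angle, \<sigma> times cosine is sine. So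
        \<open>W 1\<close> is the graph frame \<open>Y + B\<close> of the end point times a square
        matrix.\<close>
      have "diag_mat \<sigma> ** diag_mat (c 1) = diag_mat (s 1)"
        unfolding diag_mat_mult by (simp add: c_def s_def \<theta>_def sin_arctan cos_arctan)
      then have "B ** V ** diag_mat (c 1) = U ** diag_mat (s 1)"
        unfolding B by (simp add: V(2) flip: matrix_mul_assoc)
      then have "W 1 = (Y + B) ** V ** diag_mat (c 1)"
        by (simp add: W_def P_def matrix_add_left)
      also have "\<dots> = Y\<^sub>1 ** (transpose Y\<^sub>1 ** (Y + B)) ** V ** diag_mat (c 1)"
        unfolding frame(2) ..
      also have "\<dots> = Y\<^sub>1 ** (transpose Y\<^sub>1 ** (Y + B) ** V ** diag_mat (c 1))"
        by (simp only: matrix_mul_assoc)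
      finally show "col_span (W 1) \<subseteq> col_span Y\<^sub>1"
        by (simp only: col_span_mult_subset)
    qed
    show "norm (W 1 - W 0) \<le> 2 * norm (W 1 - W 0 ** (transpose (W 0) ** W 1))"
    proof -
      have "W 1 - W 0 = P ** diag_mat (c 1 - (\<chi> j. 1)) + U ** diag_mat (s 1)"
        unfolding W0 by (simp add: W_def matrix_diff_right diag_mat_1 flip: diag_mat_diff)
      then have "norm (W 1 - W 0) \<le> norm (c 1 - (\<chi> j. 1)) + norm (s 1)"
        by (simp add: norm_diag_combination_le PP U)
      also have "norm (c 1 - (\<chi> j. 1)) \<le> norm (s 1)"
      proof (rule norm_le_componentwise_cart)
        fix j
        have "0 \<le> sin (\<theta> $ j)"
          using \<theta>[of j] by (intro sin_ge_zero) auto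
        then have "(sin (\<theta> $ j))\<^sup>2 \<le> sin (\<theta> $ j)"
          by (simp add: power2_eq_square mult_left_le)
        then show "norm ((c 1 - (\<chi> j. 1)) $ j) \<le> norm (s 1 $ j)"
          using one_minus_cos_le_sin_power2[OF \<theta>, of j] by (simp add: c_def s_def)
      qed
      finally show ?thesis by (simp add: q)
    qed
    show "norm (W \<tau> - ((1 - \<tau>) *\<^sub>R W 0 + \<tau> *\<^sub>R W 1)) \<le>
       5 * (norm (W 1 - W 0 ** (transpose (W 0) ** W 1)))\<^sup>2" if \<tau>: "0 \<le> \<tau>" "\<tau> \<le> 1" for \<tau>
    proof -
      let ?a = "c \<tau> - ((1 - \<tau>) *\<^sub>R (\<chi> j. 1) + \<tau> *\<^sub>R c 1)" and ?b = "s \<tau> - \<tau> *\<^sub>R s 1"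
      have "W \<tau> - ((1 - \<tau>) *\<^sub>R W 0 + \<tau> *\<^sub>R W 1) = P ** diag_mat ?a + U ** diag_mat ?b"
        unfolding W0 by (simp add: W_def matrix_bilinear diag_mat_1 scaleR_add_right
            flip: diag_mat_diff diag_mat_add diag_mat_scaleR)
      then have "norm (W \<tau> - ((1 - \<tau>) *\<^sub>R W 0 + \<tau> *\<^sub>R W 1)) \<le> norm ?a + norm ?b"
        by (simp add: norm_diag_combination_le PP U)
      also have "\<dots> \<le> 1 * (norm (s 1))\<^sup>2 + 4 * (norm (s 1))\<^sup>2"
      proof (intro add_mono norm_le_power2_norm)
        show "\<bar>?a $ j\<bar> \<le> 1 * (s 1 $ j)\<^sup>2" for j
          using cos_chord_error[OF \<theta> \<tau>, of j] by (simp add: c_def s_def)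
        show "\<bar>?b $ j\<bar> \<le> 4 * (s 1 $ j)\<^sup>2" for j
          using sin_chord_error[OF \<theta> \<tau>, of j] by (simp add: s_def)
      qed
      finally show ?thesis by (simp add: q)
    qed
  qed
qed

subsection \<open>Interpolation error\<close>

lemma C2_on_subset: "C2_on J f \<Longrightarrow> I \<subseteq> J \<Longrightarrow> C2_on I f"
  unfolding C2_on_def
  by (meson continuous_on_subset has_vector_derivative_within_subset subsetD)

text \<open>A single \<open>K\<close> for size, Lipschitz constant and chord error. The chord error
  is a difference of two tangent errors at \<open>x\<close>, each controlled by the bound
  \<open>B2\<close> on the second derivative; hence \<open>2 * B2\<close> in
  \<open>K\<close>.\<close>

lemma C2_on_chord_bounds:
  fixes f :: "real \<Rightarrow> 'a::real_normed_vector"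
  assumes "C2_on {a..b} f"
  obtains K where "0 \<le> K"
    "\<And>x. x \<in> {a..b} \<Longrightarrow> norm (f x) \<le> K"
    "\<And>x y. x \<in> {a..b} \<Longrightarrow> y \<in> {a..b} \<Longrightarrow> norm (f y - f x) \<le> K * \<bar>y - x\<bar>"
    "\<And>x y \<tau>. x \<in> {a..b} \<Longrightarrow> y \<in> {a..b} \<Longrightarrow> \<tau> \<in> {0..1} \<Longrightarrow>
      norm (f (x + \<tau> * (y - x)) - ((1 - \<tau>) *\<^sub>R f x + \<tau> *\<^sub>R f y)) \<le> K * (y - x)\<^sup>2"
proof -
  obtain f' f'' where f': "\<And>t. t \<in> {a..b} \<Longrightarrow> (f has_vector_derivative f' t) (at t within {a..b})"
    and f'': "\<And>t. t \<in> {a..b} \<Longrightarrow> (f' has_vector_derivative f'' t) (at t within {a..b})"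
    and cont: "continuous_on {a..b} f''"
    using assms unfolding C2_on_def by blast
  have bdd: "\<exists>B\<ge>0. \<forall>x\<in>{a..b}. norm (g x) \<le> B" if g: "continuous_on {a..b} g" for g :: "real \<Rightarrow> 'a"
  proof -
    obtain B where "\<forall>x\<in>g ` {a..b}. norm x \<le> B"
      using compact_imp_bounded[OF compact_continuous_image[OF g compact_Icc]]
      unfolding bounded_iff by blast
    then show ?thesis
      by (intro exI[of _ "max 0 B"]) (auto intro: max.coboundedI2)
  qed
  have contf: "continuous_on {a..b} f" "continuous_on {a..b} f'"
    using f' f'' by (meson continuous_on_eq_continuous_within has_vector_derivative_continuous)+
  obtain B0 where B0: "0 \<le> B0" "\<And>x. x \<in> {a..b} \<Longrightarrow> norm (f x) \<le> B0" using bdd[OF contf(1)] by blast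
  obtain B1 where B1: "0 \<le> B1" "\<And>x. x \<in> {a..b} \<Longrightarrow> norm (f' x) \<le> B1" using bdd[OF contf(2)] by blast
  obtain B2 where B2: "0 \<le> B2" "\<And>x. x \<in> {a..b} \<Longrightarrow> norm (f'' x) \<le> B2" using bdd[OF cont] by blast
  have lipschitz: "norm (g y - g x) \<le> B * \<bar>y - x\<bar>"
    if "\<And>t. t \<in> {a..b} \<Longrightarrow> (g has_vector_derivative g' t) (at t within {a..b})"
      "\<And>t. t \<in> {a..b} \<Longrightarrow> norm (g' t) \<le> B" "x \<in> {a..b}" "y \<in> {a..b}" for g g' :: "real \<Rightarrow> 'a" and B x y
    using differentiable_bound[of "{a..b}" g "\<lambda>t h. h *\<^sub>R g' t" B y x] that
    by (simp add: has_vector_derivative_def onorm_scaleR_left onorm_id bounded_linear_ident)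
  have tangent: "norm (f y - f x - (y - x) *\<^sub>R f' x) \<le> B2 * (y - x)\<^sup>2"
    if x: "x \<in> {a..b}" and y: "y \<in> {a..b}" for x y
  proof -
    have sub: "closed_segment x y \<subseteq> {a..b}"
      using x y by (simp add: closed_segment_subset)
    have "norm (f y - f x - (y - x) *\<^sub>R f' x) \<le> norm (y - x) * (B2 * \<bar>y - x\<bar>)"
    proof (rule vector_differentiable_bound_linearization)
      show "closed_segment x y \<subseteq> closed_segment x y" ..
      show "(f has_vector_derivative f' t) (at t within closed_segment x y)" if "t \<in> closed_segment x y" for t
        using f' sub that has_vector_derivative_within_subset by blast
      show "norm (f' t - f' x) \<le> B2 * \<bar>y - x\<bar>" if "t \<in> closed_segment x y" for t
      proof -
        have "norm (f' t - f' x) \<le> B2 * \<bar>t - x\<bar>"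
          using f'' B2(2) x sub that by (intro lipschitz) auto
        also have "\<dots> \<le> B2 * \<bar>y - x\<bar>"
          using B2(1) that by (intro mult_left_mono) (auto simp: closed_segment_eq_real_ivl split: if_splits)
        finally show ?thesis .
      qed
    qed simp
    then show ?thesis by (simp add: power2_eq_square mult_ac flip: abs_mult)
  qed
  define K where "K = B0 + B1 + 2 * B2"
  show thesis
  proof (rule that[of K])
    show "0 \<le> K" using B0 B1 B2 by (simp add: K_def)
    show "norm (f x) \<le> K" if "x \<in> {a..b}" for x
      using B0(2)[OF that] B1(1) B2(1) by (simp add: K_def)
    show "norm (f y - f x) \<le> K * \<bar>y - x\<bar>" if "x \<in> {a..b}" "y \<in> {a..b}" for x y
    proof -
      have "norm (f y - f x) \<le> B1 * \<bar>y - x\<bar>"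
        using f' B1(2) that by (rule lipschitz)
      also have "\<dots> \<le> K * \<bar>y - x\<bar>"
        using B0 B1 B2 by (intro mult_right_mono) (auto simp: K_def)
      finally show ?thesis .
    qed
    show "norm (f (x + \<tau> * (y - x)) - ((1 - \<tau>) *\<^sub>R f x + \<tau> *\<^sub>R f y)) \<le> K * (y - x)\<^sup>2"
      if x: "x \<in> {a..b}" and y: "y \<in> {a..b}" and \<tau>: "\<tau> \<in> {0..1}" for x y \<tau>
    proof -
      let ?z = "x + \<tau> * (y - x)"
      have "?z = (1 - \<tau>) *\<^sub>R x + \<tau> *\<^sub>R y" by (simp add: algebra_simps)
      then have z: "?z \<in> {a..b}"
        using convexD[OF convex_real_interval(5)[of a b] x y, of "1 - \<tau>" \<tau>] \<tau> by simp
      \<comment> \<open>The first-order terms cancel because \<open>?z - x\<close> is \<tau> times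
        \<open>y - x\<close>.\<close>
      have "f ?z - ((1 - \<tau>) *\<^sub>R f x + \<tau> *\<^sub>R f y) =
          (f ?z - f x - (?z - x) *\<^sub>R f' x) - \<tau> *\<^sub>R (f y - f x - (y - x) *\<^sub>R f' x)"
        by (simp add: algebra_simps)
      also have "norm \<dots> \<le> B2 * (?z - x)\<^sup>2 + \<tau> * (B2 * (y - x)\<^sup>2)"
        by (rule order.trans[OF norm_triangle_ineq4 add_mono])
          (use tangent[OF x z] tangent[OF x y] \<tau> in \<open>auto intro: mult_left_mono\<close>)
      also have "\<dots> \<le> B2 * (y - x)\<^sup>2 + 1 * (B2 * (y - x)\<^sup>2)"
      proof (intro add_mono mult_left_mono mult_right_mono)
        have "\<tau>\<^sup>2 \<le> 1" using \<tau> by (simp add: power_le_one)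
        then show "(?z - x)\<^sup>2 \<le> (y - x)\<^sup>2"
          by (simp add: power_mult_distrib mult_left_le_one_le)
      qed (use B2 \<tau> in auto)
      also have "\<dots> \<le> K * (y - x)\<^sup>2"
        using B0 B1 by (simp add: K_def algebra_simps)
      finally show ?thesis .
    qed
  qed
qed

text \<open>The chord of a product differs from the product of the chords by
  \<open>\<tau> (1 - \<tau>) (W\<^sub>1 - W\<^sub>0) (M\<^sub>1 - M\<^sub>0)\<close>. This makes it possible to compare the curve, written in a smooth frame
  \<open>Z\<^sub>i = W\<^sub>i M\<^sub>i\<close>, with a geodesic frame \<open>W\<^sub>\<tau>\<close>.\<close>

lemma frame_interpolation_error:
  fixes W\<^sub>0 W\<^sub>1 W\<^sub>\<tau> Z\<^sub>0 Z\<^sub>1 Z\<^sub>\<tau> :: "real^'r^'m" and N :: "real^'r^'r"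
  assumes W: "W\<^sub>0 \<in> stiefel" "W\<^sub>1 \<in> stiefel"
    and Z\<^sub>0: "W\<^sub>0 ** (transpose W\<^sub>0 ** Z\<^sub>0) = Z\<^sub>0" and Z\<^sub>1: "W\<^sub>1 ** (transpose W\<^sub>1 ** Z\<^sub>1) = Z\<^sub>1"
    and N: "Z\<^sub>1 ** N = W\<^sub>1" "norm N \<le> R"
    and \<tau>: "0 \<le> \<tau>" "\<tau> \<le> 1" and "0 \<le> h" "0 \<le> K"
    and K: "norm Z\<^sub>0 \<le> K" "norm Z\<^sub>1 \<le> K" "norm (Z\<^sub>1 - Z\<^sub>0) \<le> K * h"
      "norm (Z\<^sub>\<tau> - ((1 - \<tau>) *\<^sub>R Z\<^sub>0 + \<tau> *\<^sub>R Z\<^sub>1)) \<le> K * h\<^sup>2"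
    and chord: "norm (W\<^sub>1 - W\<^sub>0) \<le> 2 * norm (W\<^sub>1 - W\<^sub>0 ** (transpose W\<^sub>0 ** W\<^sub>1))"
      "norm (W\<^sub>\<tau> - ((1 - \<tau>) *\<^sub>R W\<^sub>0 + \<tau> *\<^sub>R W\<^sub>1)) \<le> 5 * (norm (W\<^sub>1 - W\<^sub>0 ** (transpose W\<^sub>0 ** W\<^sub>1)))\<^sup>2"
    and \<rho>: "\<rho> = sqrt CARD('r)"
  shows "\<exists>M. norm (Z\<^sub>\<tau> - W\<^sub>\<tau> ** M) \<le> (K + 2 * K * R * (\<rho> * K + 2 * K\<^sup>2 * R) + 5 * K ^ 3 * R\<^sup>2 * \<rho>) * h\<^sup>2"
proof -
  define q where "q = norm (W\<^sub>1 - W\<^sub>0 ** (transpose W\<^sub>0 ** W\<^sub>1))"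
  define M\<^sub>0 where "M\<^sub>0 = transpose W\<^sub>0 ** Z\<^sub>0"
  define M\<^sub>1 where "M\<^sub>1 = transpose W\<^sub>1 ** Z\<^sub>1"
  define M where "M = (1 - \<tau>) *\<^sub>R M\<^sub>0 + \<tau> *\<^sub>R M\<^sub>1"
  have "0 \<le> R" using N(2) norm_ge_zero order.trans by blast
  have "0 \<le> \<rho>" by (simp add: \<rho>)
  have nW: "norm (transpose W\<^sub>0) = \<rho>" "norm (transpose W\<^sub>1) = \<rho>"
    using W by (simp_all add: norm_transpose norm_stiefel \<rho>)
  \<comment> \<open>The residual \<open>q\<close> is minimal, so it is at most that of the
    competitor \<open>M\<^sub>0 ** N\<close>, which equals
    \<open>(Z\<^sub>1 - Z\<^sub>0) ** N\<close> and is of order \<open>h\<close>.\<close>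
  have "q\<^sup>2 \<le> (norm (W\<^sub>1 - W\<^sub>0 ** (M\<^sub>0 ** N)))\<^sup>2"
    using norm_residual_power2[OF W(1), of W\<^sub>1 "M\<^sub>0 ** N"] by (simp add: q_def)
  then have "q \<le> norm (W\<^sub>1 - W\<^sub>0 ** (M\<^sub>0 ** N))"
    by (rule power2_le_imp_le) simp
  also have "W\<^sub>1 - W\<^sub>0 ** (M\<^sub>0 ** N) = (Z\<^sub>1 - Z\<^sub>0) ** N"
    using N(1) Z\<^sub>0 by (simp add: M\<^sub>0_def matrix_diff_left matrix_mul_assoc)
  also have "norm \<dots> \<le> (K * h) * R"
    using K(3) N(2) by (intro order.trans[OF norm_matrix_mult_le] mult_mono) (use \<open>0 \<le> K\<close> \<open>0 \<le> h\<close> in auto)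
  finally have q: "q \<le> K * R * h" by (simp add: mult_ac)
  have "0 \<le> q" by (simp add: q_def)
  have dW: "norm (W\<^sub>1 - W\<^sub>0) \<le> 2 * K * R * h"
    using chord(1) q by (simp add: q_def)
  have dM: "norm (M\<^sub>1 - M\<^sub>0) \<le> (\<rho> * K + 2 * K\<^sup>2 * R) * h"
  proof -
    have "M\<^sub>1 - M\<^sub>0 = transpose W\<^sub>1 ** (Z\<^sub>1 - Z\<^sub>0) + transpose (W\<^sub>1 - W\<^sub>0) ** Z\<^sub>0"
    proof -
      have "transpose (W\<^sub>1 - W\<^sub>0) = transpose W\<^sub>1 - transpose W\<^sub>0"
        by (simp add: transpose_def vec_eq_iff)
      then show ?thesis by (simp add: M\<^sub>0_def M\<^sub>1_def matrix_bilinear)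
    qed
    also have "norm \<dots> \<le> \<rho> * (K * h) + (2 * K * R * h) * K"
    proof (intro order.trans[OF norm_triangle_ineq] add_mono order.trans[OF norm_matrix_mult_le] mult_mono)
      show "norm (transpose (W\<^sub>1 - W\<^sub>0)) \<le> 2 * K * R * h"
        using dW by (simp add: norm_transpose)
    qed (use K nW \<open>0 \<le> K\<close> \<open>0 \<le> h\<close> \<open>0 \<le> R\<close> \<open>0 \<le> \<rho>\<close> in auto)
    finally show ?thesis by (simp add: algebra_simps power2_eq_square)
  qed
  have nM: "norm M \<le> \<rho> * K"
  proof -
    have "norm M\<^sub>0 \<le> \<rho> * K" "norm M\<^sub>1 \<le> \<rho> * K"
      unfolding M\<^sub>0_def M\<^sub>1_def using K nW \<open>0 \<le> \<rho>\<close>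
      by (auto intro!: order.trans[OF norm_matrix_mult_le] mult_mono)
    then have "norm M \<le> (1 - \<tau>) * (\<rho> * K) + \<tau> * (\<rho> * K)"
      unfolding M_def using \<tau>
      by (intro order.trans[OF norm_triangle_ineq] add_mono) (auto intro: mult_left_mono)
    then show ?thesis by (simp add: algebra_simps)
  qed
  let ?LZ = "(1 - \<tau>) *\<^sub>R Z\<^sub>0 + \<tau> *\<^sub>R Z\<^sub>1" and ?LW = "(1 - \<tau>) *\<^sub>R W\<^sub>0 + \<tau> *\<^sub>R W\<^sub>1"
  have ZM: "Z\<^sub>0 = W\<^sub>0 ** M\<^sub>0" "Z\<^sub>1 = W\<^sub>1 ** M\<^sub>1"
    using Z\<^sub>0 Z\<^sub>1 by (simp_all add: M\<^sub>0_def M\<^sub>1_def)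
  have chord_product: "?LZ - ?LW ** M = (\<tau> * (1 - \<tau>)) *\<^sub>R ((W\<^sub>1 - W\<^sub>0) ** (M\<^sub>1 - M\<^sub>0))"
    unfolding ZM M_def matrix_bilinear by (simp add: algebra_simps)
  \<comment> \<open>Chord error of the smooth frame, chord defect of the product and chord error of
    the geodesic frame: these give the three summands of the constant, in this order.\<close>
  have "Z\<^sub>\<tau> - W\<^sub>\<tau> ** M = (Z\<^sub>\<tau> - ?LZ) + (\<tau> * (1 - \<tau>)) *\<^sub>R ((W\<^sub>1 - W\<^sub>0) ** (M\<^sub>1 - M\<^sub>0)) - (W\<^sub>\<tau> - ?LW) ** M"
    unfolding chord_product[symmetric] by (simp add: matrix_diff_left)
  also have "norm \<dots> \<le> norm (Z\<^sub>\<tau> - ?LZ) + norm ((\<tau> * (1 - \<tau>)) *\<^sub>R ((W\<^sub>1 - W\<^sub>0) ** (M\<^sub>1 - M\<^sub>0)))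
      + norm ((W\<^sub>\<tau> - ?LW) ** M)"
    by (intro order.trans[OF norm_triangle_ineq4] add_right_mono norm_triangle_ineq)
  also have "\<dots> \<le> K * h\<^sup>2 + 1 * ((2 * K * R * h) * ((\<rho> * K + 2 * K\<^sup>2 * R) * h)) + (5 * (K * R * h)\<^sup>2) * (\<rho> * K)"
  proof (intro add_mono K(4))
    have "norm ((W\<^sub>1 - W\<^sub>0) ** (M\<^sub>1 - M\<^sub>0)) \<le> (2 * K * R * h) * ((\<rho> * K + 2 * K\<^sup>2 * R) * h)"
      using dW dM \<open>0 \<le> K\<close> \<open>0 \<le> h\<close> \<open>0 \<le> R\<close>
      by (intro order.trans[OF norm_matrix_mult_le] mult_mono) auto
    moreover have "0 \<le> \<tau> * (1 - \<tau>)" "\<tau> * (1 - \<tau>) \<le> 1"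
      using \<tau> by (auto intro: mult_le_one)
    ultimately show "norm ((\<tau> * (1 - \<tau>)) *\<^sub>R ((W\<^sub>1 - W\<^sub>0) ** (M\<^sub>1 - M\<^sub>0))) \<le> 1 * ((2 * K * R * h) * ((\<rho> * K + 2 * K\<^sup>2 * R) * h))"
      unfolding norm_scaleR by (intro mult_mono) auto
    have "norm (W\<^sub>\<tau> - ?LW) \<le> 5 * q\<^sup>2"
      using chord(2) by (simp add: q_def)
    also have "\<dots> \<le> 5 * (K * R * h)\<^sup>2"
      using q \<open>0 \<le> q\<close> by (simp add: power_mono)
    finally show "norm ((W\<^sub>\<tau> - ?LW) ** M) \<le> (5 * (K * R * h)\<^sup>2) * (\<rho> * K)"
      using nM by (intro order.trans[OF norm_matrix_mult_le] mult_mono) auto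
  qed
  also have "\<dots> = (K + 2 * K * R * (\<rho> * K + 2 * K\<^sup>2 * R) + 5 * K ^ 3 * R\<^sup>2 * \<rho>) * h\<^sup>2"
    by (simp add: algebra_simps power2_eq_square power3_eq_cube)
  finally show ?thesis ..
qed

lemma gr_chart_domain_stiefel:
  fixes Y\<^sub>0 :: "real^'r^'m"
  assumes "S \<in> gr_chart_domain Y\<^sub>0"
  obtains Y :: "real^'r^'m" where "Y \<in> stiefel" "col_span Y = S"
  using assms unfolding gr_chart_domain_def by blast

text \<open>Within one chart the curve has the smooth frame \<open>Z\<close>, with uniform bounds on
  a compact interval inside the chart neighbourhood; \<open>a\<close> and \<open>b\<close> may then
  be any two nearby parameters.\<close>

lemma glerp_local_error:
  fixes \<gamma> :: "real \<Rightarrow> (real^'m::finite) set"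
  assumes \<gamma>: "gr_C2_curve_on TYPE('r::finite) {0..T} \<gamma>" and t: "t \<in> {0..T}"
  obtains \<delta> C where "0 < \<delta>" "0 \<le> C"
    "\<And>a b \<tau>. a \<in> ball t \<delta> \<inter> {0..T} \<Longrightarrow> b \<in> ball t \<delta> \<inter> {0..T} \<Longrightarrow> a \<le> b \<Longrightarrow>
       \<gamma> b \<in> gr_chart_domain (gr_rep (\<gamma> a) :: real^'r^'m) \<Longrightarrow> 0 \<le> \<tau> \<Longrightarrow> \<tau> \<le> 1 \<Longrightarrow>
       gr_dist TYPE('r) (\<gamma> (a + \<tau> * (b - a))) (glerp TYPE('r) (\<gamma> a) (\<gamma> b) \<tau>) \<le> C * (b - a)\<^sup>2"
proof -
  obtain Y\<^sub>0 :: "real^'r^'m" and I where Y\<^sub>0: "Y\<^sub>0 \<in> stiefel" and I: "open I" "t \<in> I"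
    and dom: "\<gamma> ` (I \<inter> {0..T}) \<subseteq> gr_chart_domain Y\<^sub>0"
    and C2: "C2_on (I \<inter> {0..T}) (\<lambda>s. gr_chart Y\<^sub>0 (\<gamma> s))"
    using \<gamma> t unfolding gr_C2_curve_on_def by blast
  obtain \<delta> where \<delta>: "0 < \<delta>" "cball t \<delta> \<subseteq> I"
    using I open_contains_cball by blast
  define J where "J = {max 0 (t - \<delta>)..min T (t + \<delta>)}"
  have J: "J = cball t \<delta> \<inter> {0..T}"
    by (auto simp: J_def dist_real_def)
  have JI: "J \<subseteq> I \<inter> {0..T}" using J \<delta> by auto
  define Z where "Z x = Y\<^sub>0 + gr_chart Y\<^sub>0 (\<gamma> x)" for x
  have "C2_on J Z"
  proof -
    obtain f' f'' where f: "\<forall>t\<in>J. ((\<lambda>s. gr_chart Y\<^sub>0 (\<gamma> s)) has_vector_derivative f' t) (at t within J) \<and>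
        (f' has_vector_derivative f'' t) (at t within J)" "continuous_on J f''"
      using C2_on_subset[OF C2 JI] unfolding C2_on_def by blast
    then show ?thesis
      unfolding C2_on_def Z_def by (intro exI[of _ f'] exI[of _ f'']) (auto intro!: derivative_eq_intros)
  qed
  then obtain K where K: "0 \<le> K" "\<And>x. x \<in> J \<Longrightarrow> norm (Z x) \<le> K"
    "\<And>x y. x \<in> J \<Longrightarrow> y \<in> J \<Longrightarrow> norm (Z y - Z x) \<le> K * \<bar>y - x\<bar>"
    "\<And>x y \<tau>. x \<in> J \<Longrightarrow> y \<in> J \<Longrightarrow> \<tau> \<in> {0..1} \<Longrightarrow>
      norm (Z (x + \<tau> * (y - x)) - ((1 - \<tau>) *\<^sub>R Z x + \<tau> *\<^sub>R Z y)) \<le> K * (y - x)\<^sup>2"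
    unfolding J_def by (rule C2_on_chord_bounds) blast
  have frame: "Z x ** (transpose Y\<^sub>0 ** Y) = Y" "Y ** (transpose Y ** Z x) = Z x"
    if "x \<in> J" "Y \<in> stiefel" "col_span Y = \<gamma> x" for x and Y :: "real^'r^'m"
  proof -
    have "\<gamma> x \<in> gr_chart_domain Y\<^sub>0" using that(1) dom JI by blast
    then show "Z x ** (transpose Y\<^sub>0 ** Y) = Y" "Y ** (transpose Y ** Z x) = Z x"
      using gr_chart_frame(1,2)[OF that(2), of Y\<^sub>0] that(3) by (simp_all add: Z_def)
  qed
  have rep: "\<exists>Y :: real^'r^'m. Y \<in> stiefel \<and> col_span Y = \<gamma> x" if "x \<in> J" for x
    using that dom JI gr_chart_domain_stiefel by (metis image_subset_iff subsetD)
  define \<rho> where "\<rho> = sqrt CARD('r)"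
  define R where "R = \<rho> * \<rho>"
  have "0 \<le> \<rho>" by (simp add: \<rho>_def)
  have N: "norm (transpose Y\<^sub>0 ** Y) \<le> R" if "Y \<in> stiefel" for Y :: "real^'r^'m"
    using norm_matrix_mult_le[of "transpose Y\<^sub>0" Y] norm_stiefel[OF that] norm_stiefel[OF Y\<^sub>0]
    by (simp add: norm_transpose R_def \<rho>_def)
  define C where "C = K + 2 * K * R * (\<rho> * K + 2 * K\<^sup>2 * R) + 5 * K ^ 3 * R\<^sup>2 * \<rho>"
  have "0 \<le> C" "0 \<le> R" using K(1) \<open>0 \<le> \<rho>\<close> by (simp_all add: C_def R_def)
  show thesis
  \<comment> \<open>The 2 stems from \<open>gr_dist_le_residual\<close>; \<open>R\<close> bounds the
    factor \<open>?N\<close> that turns \<open>Z\<close> into an orthonormal frame.\<close>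
  proof (rule that[of \<delta> "2 * (C * R)"])
    fix a b \<tau> :: real
    assume "a \<in> ball t \<delta> \<inter> {0..T}" "b \<in> ball t \<delta> \<inter> {0..T}" "a \<le> b"
      and chart: "\<gamma> b \<in> gr_chart_domain (gr_rep (\<gamma> a) :: real^'r^'m)" and \<tau>: "0 \<le> \<tau>" "\<tau> \<le> 1"
    then have ab: "a \<in> J" "b \<in> J" using J by auto
    let ?x = "a + \<tau> * (b - a)"
    have "?x = (1 - \<tau>) *\<^sub>R a + \<tau> *\<^sub>R b" by (simp add: algebra_simps)
    then have x: "?x \<in> J"
      using convexD[OF convex_real_interval(5) ab[unfolded J_def], of "1 - \<tau>" \<tau>] \<tau> by (simp add: J_def)
    obtain Ya Yb Yx :: "real^'r^'m" where Ya: "Ya \<in> stiefel" "col_span Ya = \<gamma> a"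
      and Yb: "Yb \<in> stiefel" "col_span Yb = \<gamma> b" and Yx: "Yx \<in> stiefel" "col_span Yx = \<gamma> ?x"
      using rep ab x by meson
    obtain W :: "real \<Rightarrow> real^'r^'m" where W: "\<And>\<tau>. W \<tau> \<in> stiefel"
      and glerp: "\<And>\<tau>. 0 \<le> \<tau> \<Longrightarrow> glerp TYPE('r) (\<gamma> a) (\<gamma> b) \<tau> = col_span (W \<tau>)"
      and span: "col_span (W 0) = \<gamma> a" "col_span (W 1) = \<gamma> b"
      and chord: "norm (W 1 - W 0) \<le> 2 * norm (W 1 - W 0 ** (transpose (W 0) ** W 1))"
        "\<And>\<tau>. 0 \<le> \<tau> \<Longrightarrow> \<tau> \<le> 1 \<Longrightarrow> norm (W \<tau> - ((1 - \<tau>) *\<^sub>R W 0 + \<tau> *\<^sub>R W 1)) \<le>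
          5 * (norm (W 1 - W 0 ** (transpose (W 0) ** W 1)))\<^sup>2"
      using glerp_frame[OF Ya(1) Yb(1), unfolded Ya(2) Yb(2), OF chart] by metis
    have "\<exists>M. norm (Z ?x - W \<tau> ** M) \<le> C * (b - a)\<^sup>2"
      unfolding C_def
    proof (rule frame_interpolation_error[OF W W _ _ _ _ \<tau> _ K(1) _ _ _ _ chord(1) chord(2)[OF \<tau>] \<rho>_def])
      show "W 0 ** (transpose (W 0) ** Z a) = Z a" "W 1 ** (transpose (W 1) ** Z b) = Z b"
        using frame(2) ab W span by auto
      show "Z b ** (transpose Y\<^sub>0 ** W 1) = W 1" "norm (transpose Y\<^sub>0 ** W 1) \<le> R"
        using frame(1) N ab W span by auto
      show "norm (Z b - Z a) \<le> K * (b - a)"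
        using K(3)[OF ab] \<open>a \<le> b\<close> by simp
    qed (use K ab \<open>a \<le> b\<close> \<tau> in auto)
    then obtain M where M: "norm (Z ?x - W \<tau> ** M) \<le> C * (b - a)\<^sup>2" ..
    let ?N = "transpose Y\<^sub>0 ** Yx"
    have "gr_dist TYPE('r) (\<gamma> ?x) (glerp TYPE('r) (\<gamma> a) (\<gamma> b) \<tau>) \<le> 2 * norm (Yx - W \<tau> ** (M ** ?N))"
      using gr_dist_le_residual[OF Yx(1) W, of \<tau>] glerp[OF \<tau>(1)] Yx(2) by simp
    also have "Yx - W \<tau> ** (M ** ?N) = (Z ?x - W \<tau> ** M) ** ?N"
      using frame(1)[OF x Yx] by (simp add: matrix_diff_left matrix_mul_assoc)
    also have "norm \<dots> \<le> (C * (b - a)\<^sup>2) * R"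
      by (rule order.trans[OF norm_matrix_mult_le mult_mono]) (use M N[OF Yx(1)] \<open>0 \<le> C\<close> in auto)
    finally show "gr_dist TYPE('r) (\<gamma> ?x) (glerp TYPE('r) (\<gamma> a) (\<gamma> b) \<tau>) \<le> 2 * (C * R) * (b - a)\<^sup>2"
      by (simp add: mult_ac)
  qed (use \<delta> \<open>0 \<le> C\<close> \<open>0 \<le> R\<close> in auto)
qed

section \<open>Uniform constant by compactness\<close>

theorem proposition3p2:
  fixes \<gamma> :: "real \<Rightarrow> (real^'m::finite) set" and T :: real
  assumes "0 < T"
    and "\<And>t. t \<in> {0..T} \<Longrightarrow> \<gamma> t \<in> grassmannian CARD('r::finite)"
    and "gr_C2_curve_on TYPE('r) {0..T} \<gamma>"
  shows "\<exists>C. \<forall>h>0. \<forall>i::nat. \<forall>t\<^sub>0 t\<^sub>1. t\<^sub>0 = real i * h \<longrightarrow> t\<^sub>1 = real (i + 1) * h \<longrightarrow> t\<^sub>1 \<le> T \<longrightarrow>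
           \<gamma> t\<^sub>1 \<in> gr_chart_domain (gr_rep (\<gamma> t\<^sub>0) :: real^'r^'m) \<longrightarrow>
           (\<exists>N. normal_coordinate_nbhd TYPE('r) N \<and>
                \<gamma> ` {t\<^sub>0..t\<^sub>1} \<subseteq> N \<and> \<gamma> t\<^sub>0 \<in> N \<and> \<gamma> t\<^sub>1 \<in> N) \<longrightarrow>
           (\<forall>\<tau>\<in>{0..1}.
              gr_dist TYPE('r) (\<gamma> (t\<^sub>0 + \<tau> * h)) (glerp TYPE('r) (\<gamma> t\<^sub>0) (\<gamma> t\<^sub>1) \<tau>) \<le> C * h\<^sup>2)"
proof -
  have rep: "\<exists>Y :: real^'r^'m. Y \<in> stiefel \<and> col_span Y = \<gamma> t" if "t \<in> {0..T}" for t
  proof -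
    obtain Y\<^sub>0 :: "real^'r^'m" and I where "t \<in> I" "\<gamma> ` (I \<inter> {0..T}) \<subseteq> gr_chart_domain Y\<^sub>0"
      using assms(3) \<open>t \<in> {0..T}\<close> unfolding gr_C2_curve_on_def by blast
    then have "\<gamma> t \<in> gr_chart_domain Y\<^sub>0" using that by blast
    then show ?thesis using gr_chart_domain_stiefel by metis
  qed
  let ?err = "\<lambda>a b \<tau>. gr_dist TYPE('r) (\<gamma> (a + \<tau> * (b - a))) (glerp TYPE('r) (\<gamma> a) (\<gamma> b) \<tau>)"
  have "\<forall>t\<in>{0..T}. \<exists>\<delta> C. 0 < \<delta> \<and> 0 \<le> C \<and>
    (\<forall>a b \<tau>. a \<in> ball t \<delta> \<inter> {0..T} \<longrightarrow> b \<in> ball t \<delta> \<inter> {0..T} \<longrightarrow> a \<le> b \<longrightarrow>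
       \<gamma> b \<in> gr_chart_domain (gr_rep (\<gamma> a) :: real^'r^'m) \<longrightarrow> 0 \<le> \<tau> \<longrightarrow> \<tau> \<le> 1 \<longrightarrow>
       ?err a b \<tau> \<le> C * (b - a)\<^sup>2)"
    using glerp_local_error[OF assms(3)] by metis
  then obtain \<delta> C where \<delta>: "\<And>t. t \<in> {0..T} \<Longrightarrow> 0 < \<delta> t" and C: "\<And>t. t \<in> {0..T} \<Longrightarrow> 0 \<le> C t"
    and local: "\<And>t a b \<tau>. t \<in> {0..T} \<Longrightarrow> a \<in> ball t (\<delta> t) \<inter> {0..T} \<Longrightarrow> b \<in> ball t (\<delta> t) \<inter> {0..T} \<Longrightarrow> a \<le> b \<Longrightarrow>
       \<gamma> b \<in> gr_chart_domain (gr_rep (\<gamma> a) :: real^'r^'m) \<Longrightarrow> 0 \<le> \<tau> \<Longrightarrow> \<tau> \<le> 1 \<Longrightarrow> ?err a b \<tau> \<le> C t * (b - a)\<^sup>2"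
    unfolding bchoice_iff by metis
  have cover: "{0..T} \<subseteq> (\<Union>t\<in>{0..T}. ball t (\<delta> t))"
    using \<delta> by auto
  obtain D where D: "D \<subseteq> {0..T}" "finite D" "{0..T} \<subseteq> (\<Union>t\<in>D. ball t (\<delta> t))"
    using compactE_image[OF compact_Icc _ cover] by (metis open_ball)
  \<comment> \<open>A Lebesgue number of the finite cover: parameters closer than \<epsilon> share
    one of its balls, so a local estimate applies.\<close>
  obtain \<epsilon> where \<epsilon>: "0 < \<epsilon>" "\<And>x. x \<in> {0..T} \<Longrightarrow> \<exists>t\<in>D. ball x \<epsilon> \<subseteq> ball t (\<delta> t)"
    using Heine_Borel_lemma[OF compact_Icc D(3)] by auto
  \<comment> \<open>The sum dominates every local constant of the finite cover. The other summand
    handles steps of length at least \<epsilon>, where the distance is at most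
    \<open>2 * sqrt CARD('r)\<close>.\<close>
  define K where "K = (\<Sum>t\<in>D. C t) + 2 * sqrt CARD('r) / \<epsilon>\<^sup>2"
  have "?err a b \<tau> \<le> K * (b - a)\<^sup>2"
    if ab: "a \<in> {0..T}" "b \<in> {0..T}" "a < b" and \<tau>: "0 \<le> \<tau>" "\<tau> \<le> 1"
      and chart: "\<gamma> b \<in> gr_chart_domain (gr_rep (\<gamma> a) :: real^'r^'m)" for a b \<tau>
  proof (cases "b - a < \<epsilon>")
    case True
    obtain t where t: "t \<in> D" "ball a \<epsilon> \<subseteq> ball t (\<delta> t)" using \<epsilon>(2)[OF ab(1)] by blast
    have "a \<in> ball a \<epsilon>" "b \<in> ball a \<epsilon>"
      using True \<epsilon>(1) ab by (auto simp: dist_real_def)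
    with t(2) have "a \<in> ball t (\<delta> t)" "b \<in> ball t (\<delta> t)" by blast+
    then have "?err a b \<tau> \<le> C t * (b - a)\<^sup>2"
      using t D(1) ab \<tau> chart by (intro local) auto
    also have "C t \<le> (\<Sum>t\<in>D. C t)"
      using D C t by (intro member_le_sum) auto
    then have "C t * (b - a)\<^sup>2 \<le> K * (b - a)\<^sup>2"
      by (intro mult_right_mono) (simp_all add: K_def add_increasing2)
    finally show ?thesis .
  next
    case False
    have "a + \<tau> * (b - a) = (1 - \<tau>) *\<^sub>R a + \<tau> *\<^sub>R b" by (simp add: algebra_simps)
    then have x: "a + \<tau> * (b - a) \<in> {0..T}"
      using convexD[OF convex_real_interval(5) ab(1,2), of "1 - \<tau>" \<tau>] \<tau> by simp
    obtain Ya Yb Yx :: "real^'r^'m" where Ya: "Ya \<in> stiefel" "col_span Ya = \<gamma> a"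
      and Yb: "Yb \<in> stiefel" "col_span Yb = \<gamma> b"
      and Yx: "Yx \<in> stiefel" "col_span Yx = \<gamma> (a + \<tau> * (b - a))"
      using rep ab x by meson
    obtain W :: "real^'r^'m" where W: "W \<in> stiefel" "glerp TYPE('r) (\<gamma> a) (\<gamma> b) \<tau> = col_span W"
      using glerp_frame[OF Ya(1) Yb(1), unfolded Ya(2) Yb(2), OF chart] \<tau>(1) by metis
    \<comment> \<open>With \<open>M = 0\<close> the residual is the orthonormal frame itself, of
      norm \<open>sqrt CARD('r)\<close>.\<close>
    have "?err a b \<tau> \<le> 2 * sqrt CARD('r)"
      using gr_dist_le_residual[OF Yx(1) W(1), of 0] norm_stiefel[OF Yx(1)] W(2) Yx(2) by simp
    also have "\<dots> = (2 * sqrt CARD('r) / \<epsilon>\<^sup>2) * \<epsilon>\<^sup>2"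
      using \<epsilon>(1) by simp
    also have "\<dots> \<le> K * (b - a)\<^sup>2"
    proof (intro mult_mono power_mono)
      show "2 * sqrt CARD('r) / \<epsilon>\<^sup>2 \<le> K" "0 \<le> K"
        using C D(1) by (auto simp: K_def intro!: sum_nonneg add_nonneg_nonneg)
    qed (use False \<epsilon>(1) in auto)
    finally show ?thesis .
  qed
  note err = this
  show ?thesis
  proof (intro exI[of _ K] allI impI ballI)
    fix h :: real and i :: nat and t\<^sub>0 t\<^sub>1 \<tau> :: real
    assume "0 < h" "t\<^sub>0 = real i * h" "t\<^sub>1 = real (i + 1) * h" "t\<^sub>1 \<le> T" "\<tau> \<in> {0..1}"
      and chart: "\<gamma> t\<^sub>1 \<in> gr_chart_domain (gr_rep (\<gamma> t\<^sub>0) :: real^'r^'m)"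
    then have "t\<^sub>1 - t\<^sub>0 = h" "0 \<le> t\<^sub>0" "t\<^sub>0 < t\<^sub>1"
      by (auto simp: algebra_simps)
    then show "gr_dist TYPE('r) (\<gamma> (t\<^sub>0 + \<tau> * h)) (glerp TYPE('r) (\<gamma> t\<^sub>0) (\<gamma> t\<^sub>1) \<tau>) \<le> K * h\<^sup>2"
      using err[of t\<^sub>0 t\<^sub>1 \<tau>] chart \<open>t\<^sub>1 \<le> T\<close> \<open>\<tau> \<in> {0..1}\<close> by simp
  qed
qed

end
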